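(* Let $L:\mathbb{R}^m\times\mathcal{S}\to[0,1]$ be a loss such that $L(\alpha,\cdot)$ is continuous on $\mathcal{S}$ for each fixed $\alpha\in\mathbb{R}^m$. Let $\varphi:\mathbb{R}^m\times\mathcal{S}\to\mathbb{R}_+$ be a surrogate loss satisfying $R_\varphi(f)<+\infty$ for some measurable $f$. (1) Suppose that $\mathcal{S}$ is finite and that $L$ takes on only finitely many values. Then: (a) If $\varphi$ is structure-consistent with respect to $L$, then $\varphi$ is uniformly Fisher-consistent for the loss $L$. (b) If $\varphi$ is Fisher-consistent for the loss $L$, then $\varphi$ is structure-consistent with respect to $L$. (2) Suppose instead that the topological space $\mathcal{S}$ is compact and that, for some $d\in\mathbb{N}$, there exists a partition $\mathcal{A}_1,\dots,\mathcal{A}_d$ of $\mathbb{R}^m$ such that for every $s\in\mathcal{S}$, $L(\alpha,s)=L(\alpha',s)$ whenever $\alpha,\alpha'\in\mathcal{A}_i$ for some $i$. If in addition $\varphi(\cdot,s)$ is convex for each $s\in\mathcal{S}$, and for each $\mu\in\mathcal{M}(\mathcal{S})$ one has $\ell_\varphi(\alpha,\mu)\to\infty$ as $\|\alpha\|\to\infty$, then (a) and (b) hold.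
   Context: Setting. $\mathcal{Q}$ is a countable (or finite) set of queries, $m\in\mathbb{N}$, and $\mathcal{S}$ is a topological space of "structures". $\mathcal{M}(\mathcal{S})$ is the closure of the subset of probability measures on $\mathcal{S}$ for which the conditional risk $\ell$ below is defined. Scoring functions are measurable functions $f:\mathcal{Q}\to\mathbb{R}^m$. Query probabilities $p_q\ge 0$, $\sum_{q}p_q=1$, and measures $\mu_q\in\mathcal{M}(\mathcal{S})$, $q\in\mathcal{Q}$, are given. Conditional risk: $\ell(\alpha,\mu)=\int_{\mathcal{S}}L(\alpha,s)\,d\mu(s)$. Risk: $R(f)=\sum_q p_q\,\ell(f(q),\mu_q)$, with $R^*=\inf_f R(f)$ over measurable $f$. Surrogate: for each fixed $\alpha$ the map $s\mapsto\varphi(\alpha,s)$ is continuous on $\mathcal{S}$. Conditional surrogate risk: $\ell_\varphi(\alpha,\mu)=\int_{\mathcal{S}}\varphi(\alpha,s)\,d\mu(s)$. Surrogate risk: $R_\varphi(f)=\sum_q p_q\,\ell_\varphi(f(q),\mu_q)$ if each $\ell_\varphi(f(q),\mu_q)$ exists, and $R_\varphi(f)=+\infty$ otherwise. $R_\varphi^*=\inf_f R_\varphi(f)$; it is assumed throughout that some measurable $f$ has $R_\varphi(f)<+\infty$, so that $R_\varphi^*$ is finite. Fisher-consistent: for any $\{p_q\}$ and any probability measures $\mu_q\in\mathcal{M}(\mathcal{S})$, $R_\varphi(f_n)\to R_\varphi^*$ implies $R(f_n)\to R^*$. Uniformly Fisher-consistent: for any $\varepsilon>0$ there exists $\delta(\varepsilon)>0$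 such that for any $\{p_q\}$ and any probability measures $\mu_q\in\mathcal{M}(\mathcal{S})$, $R_\varphi(f)<R_\varphi^*+\delta(\varepsilon)$ implies $R(f)<R^*+\varepsilon$. Structure-consistent with respect to $L$: this notion is defined for a bounded-below surrogate $\varphi$ such that $\varphi(\cdot,s)$ is continuous for all $s\in\mathcal{S}$; it requires that for all $\mu\in\mathcal{M}(\mathcal{S})$, $$\inf_\alpha \ell_\varphi(\alpha,\mu)<\inf_\alpha\Bigl\{\ell_\varphi(\alpha,\mu)\ \Big|\ \alpha\notin\operatorname{argmin}_{\alpha'}\ell(\alpha',\mu)\Bigr\},$$ where the infimum over the empty set is $+\infty$. *)

theory Defs
  imports "HOL-Probability.Probability" "HOL-Library.Disjoint_Sets"
begin

definition borel_probs :: "'s::topological_space measure set" where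
  "borel_probs = {\<mu>. prob_space \<mu> \<and> sets \<mu> = sets borel}"

text \<open>Closure in the topology of weak convergence on Borel probability measures,
  i.e. the coarsest topology making \<open>\<mu> \<mapsto> \<integral>g d\<mu>\<close> continuous for every bounded
  continuous \<open>g\<close>.\<close>

definition weak_closure :: "'s::topological_space measure set \<Rightarrow> 's measure set" where
  "weak_closure A = {\<nu> \<in> borel_probs. \<forall>G e.
     finite G \<and> (\<forall>g\<in>G. continuous_on UNIV g \<and> bounded (range g)) \<and> e > 0 \<longrightarrow>
     (\<exists>\<mu>\<in>A. \<forall>g\<in>G. \<bar>(LINT s|\<mu>. g s) - (LINT s|\<nu>. (g s :: real))\<bar> < e)}"

definition measure_class :: "('a \<Rightarrow> 's::topological_space \<Rightarrow> real) \<Rightarrow> 's measure set" where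
  "measure_class L = weak_closure {\<mu> \<in> borel_probs. \<forall>\<alpha>. integrable \<mu> (L \<alpha>)}"

definition query_data ::
  "'q set \<Rightarrow> ('a \<Rightarrow> 's::topological_space \<Rightarrow> real) \<Rightarrow> ('q \<Rightarrow> real) \<Rightarrow> ('q \<Rightarrow> 's measure) \<Rightarrow> bool" where
  "query_data Q L p \<mu> \<longleftrightarrow>
     (\<forall>q\<in>Q. 0 \<le> p q) \<and> (p has_sum 1) Q \<and> (\<forall>q\<in>Q. \<mu> q \<in> measure_class L)"

definition scorers :: "'q set \<Rightarrow> ('q \<Rightarrow> 'a::topological_space) set" where
  "scorers Q = measurable (count_space Q) borel"

definition cond_risk :: "('a \<Rightarrow> 's \<Rightarrow> real) \<Rightarrow> 'a \<Rightarrow> 's measure \<Rightarrow> real" where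
  "cond_risk L \<alpha> \<mu> = (LINT s|\<mu>. L \<alpha> s)"

definition risk ::
  "'q set \<Rightarrow> ('a \<Rightarrow> 's \<Rightarrow> real) \<Rightarrow> ('q \<Rightarrow> real) \<Rightarrow> ('q \<Rightarrow> 's measure) \<Rightarrow> ('q \<Rightarrow> 'a) \<Rightarrow> real" where
  "risk Q L p \<mu> f = (\<Sum>\<^sub>\<infinity>q\<in>Q. p q * cond_risk L (f q) (\<mu> q))"

definition opt_risk ::
  "'q set \<Rightarrow> ('a::topological_space \<Rightarrow> 's \<Rightarrow> real) \<Rightarrow> ('q \<Rightarrow> real) \<Rightarrow> ('q \<Rightarrow> 's measure) \<Rightarrow> real" where
  "opt_risk Q L p \<mu> = (INF f\<in>scorers Q. risk Q L p \<mu> f)"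

text \<open>Surrogates \<open>\<phi>\<close> are used only under the assumption \<open>\<phi> \<ge> 0\<close>, so the extended
  non-negative integral is the Lebesgue integral, with value \<open>\<infinity>\<close> when \<open>\<phi> \<alpha>\<close> is
  not integrable.\<close>

definition cond_surr :: "('a \<Rightarrow> 's \<Rightarrow> real) \<Rightarrow> 'a \<Rightarrow> 's measure \<Rightarrow> ennreal" where
  "cond_surr \<phi> \<alpha> \<mu> = (\<integral>\<^sup>+ s. ennreal (\<phi> \<alpha> s) \<partial>\<mu>)"

definition surr_risk ::
  "'q set \<Rightarrow> ('a \<Rightarrow> 's \<Rightarrow> real) \<Rightarrow> ('q \<Rightarrow> real) \<Rightarrow> ('q \<Rightarrow> 's measure) \<Rightarrow> ('q \<Rightarrow> 'a) \<Rightarrow> ennreal" where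
  "surr_risk Q \<phi> p \<mu> f =
     (if \<forall>q\<in>Q. integrable (\<mu> q) (\<phi> (f q))
      then \<Sum>\<^sub>\<infinity>q\<in>Q. ennreal (p q) * cond_surr \<phi> (f q) (\<mu> q) else \<infinity>)"

definition opt_surr_risk ::
  "'q set \<Rightarrow> ('a::topological_space \<Rightarrow> 's \<Rightarrow> real) \<Rightarrow> ('q \<Rightarrow> real) \<Rightarrow> ('q \<Rightarrow> 's measure) \<Rightarrow> ennreal" where
  "opt_surr_risk Q \<phi> p \<mu> = (INF f\<in>scorers Q. surr_risk Q \<phi> p \<mu> f)"

definition fisher_consistent ::
  "'q set \<Rightarrow> ('a::topological_space \<Rightarrow> 's::topological_space \<Rightarrow> real) \<Rightarrow> ('a \<Rightarrow> 's \<Rightarrow> real) \<Rightarrow> bool" where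
  "fisher_consistent Q L \<phi> \<longleftrightarrow>
     (\<forall>p \<mu>. query_data Q L p \<mu> \<longrightarrow>
       (\<forall>f :: nat \<Rightarrow> 'q \<Rightarrow> 'a. (\<forall>n. f n \<in> scorers Q) \<longrightarrow>
         (\<lambda>n. surr_risk Q \<phi> p \<mu> (f n)) \<longlonglongrightarrow> opt_surr_risk Q \<phi> p \<mu> \<longrightarrow>
         (\<lambda>n. risk Q L p \<mu> (f n)) \<longlonglongrightarrow> opt_risk Q L p \<mu>))"

definition uniformly_fisher_consistent ::
  "'q set \<Rightarrow> ('a::topological_space \<Rightarrow> 's::topological_space \<Rightarrow> real) \<Rightarrow> ('a \<Rightarrow> 's \<Rightarrow> real) \<Rightarrow> bool" where
  "uniformly_fisher_consistent Q L \<phi> \<longleftrightarrow>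
     (\<forall>\<epsilon>>0. \<exists>\<delta>>0. \<forall>p \<mu>. query_data Q L p \<mu> \<longrightarrow>
       (\<forall>f \<in> scorers Q.
         surr_risk Q \<phi> p \<mu> f < opt_surr_risk Q \<phi> p \<mu> + ennreal \<delta> \<longrightarrow>
         risk Q L p \<mu> f < opt_risk Q L p \<mu> + \<epsilon>))"

text \<open>To be used only for \<open>\<phi> \<ge> 0\<close> that is continuous in its first argument. In
  \<^typ>\<open>ennreal\<close> the infimum of the empty set is \<open>\<infinity>\<close>.\<close>

definition structure_consistent ::
  "('a \<Rightarrow> 's::topological_space \<Rightarrow> real) \<Rightarrow> ('a \<Rightarrow> 's \<Rightarrow> real) \<Rightarrow> bool" where
  "structure_consistent L \<phi> \<longleftrightarrow>
     (\<forall>\<mu> \<in> measure_class L.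
       (INF \<alpha>. cond_surr \<phi> \<alpha> \<mu>) <
       (INF \<alpha> \<in> {\<alpha>. \<not> is_arg_min (\<lambda>\<alpha>'. cond_risk L \<alpha>' \<mu>) (\<lambda>_. True) \<alpha>}. cond_surr \<phi> \<alpha> \<mu>))"

end

(* Given f, replace f(q) by a better score g(q) at every query where the conditional risk exceeds
   its minimum by eps/2. If each such replacement lowers the conditional surrogate risk by at least
   some h > 0 independent of the measure, then surr_risk f >= opt_surr_risk + h * P, where P is the
   mass of the bad queries, so a near-optimal f has small P and hence small excess risk.

   A uniform h exists by compactness. If S is finite, a sequence of measures violating it has a limit,
   which contradicts structure consistency there. In the convex case the near-minimisers stay in a
   ball and converge to some alpha; by a separation argument in R^m x R there is a finitely
   supported measure minimised at alpha that again contradicts structure consistency, so no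
   representation theorem for measures on S is needed.

   For the converse direction, put all mass on a single query: a sequence of non-minimisers of the
   conditional risk with optimal surrogate risk contradicts Fisher consistency, because the
   conditional risk takes finitely many values. *)

theory Submission
  imports Defs
begin

subsection \<open>Sums, measures and subgradients\<close>

text \<open>Queries carry the discrete sigma-algebra, so better scores may be chosen query by query
  without a measurability check.\<close>

lemma scorers_eq_UNIV: "scorers Q = UNIV"
  by (auto simp: scorers_def)

section \<open>Infinite sums and uniform positive thresholds\<close>

lemma infsum_ennreal:
  fixes z :: "'q \<Rightarrow> real"
  assumes "z summable_on Q" "\<And>q. q \<in> Q \<Longrightarrow> 0 \<le> z q"
  shows "(\<Sum>\<^sub>\<infinity>q\<in>Q. ennreal (z q)) = ennreal (infsum z Q)"
proof -
  have "(\<Sum>\<^sub>\<infinity>q\<in>Q. ennreal (z q)) = (SUP F\<in>{F. finite F \<and> F \<subseteq> Q}. \<Sum>q\<in>F. ennreal (z q))"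
    by (intro nonneg_infsum_complete) simp
  also have "\<dots> = (SUP F\<in>{F. finite F \<and> F \<subseteq> Q}. ennreal (sum z F))"
    using assms(2) by (intro SUP_cong refl sum_ennreal) auto
  also have "\<dots> = ennreal (infsum z Q)"
    by (rule infsum_nonneg_is_SUPREMUM_ennreal[OF assms, symmetric])
  finally show ?thesis .
qed

lemma finite_uniform_positive:
  assumes "finite X" and "\<And>x. x \<in> X \<Longrightarrow> \<exists>h>0. P x (h::real)"
    and mono: "\<And>x h h'. P x h \<Longrightarrow> h' \<le> h \<Longrightarrow> P x h'"
  shows "\<exists>h>0. \<forall>x\<in>X. P x h"
  using assms(1,2)
proof (induction X)
  case empty
  show ?case by (intro exI[of _ 1]) auto
next
  case (insert x X)
  then obtain h1 h2 where "h1 > 0" "\<forall>x\<in>X. P x h1" "h2 > 0" "P x h2"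
    by (metis insertCI)
  then show ?case
    using mono[of _ h1 "min h1 h2"] mono[of _ h2 "min h1 h2"]
    by (intro exI[of _ "min h1 h2"]) auto
qed

section \<open>Borel probability measures and finite weights\<close>

lemma integrable_borel_probs:
  fixes g :: "'s::topological_space \<Rightarrow> real"
  assumes "compact (UNIV :: 's set)" "continuous_on UNIV g" "\<mu> \<in> borel_probs"
  shows "integrable \<mu> g"
proof -
  interpret prob_space \<mu> using assms(3) by (simp add: borel_probs_def)
  have sets: "sets \<mu> = sets borel" using assms(3) by (simp add: borel_probs_def)
  have "bounded (range g)"
    using assms(1,2) compact_continuous_image compact_imp_bounded by blast
  then obtain B where "\<And>s. norm (g s) \<le> B" by (auto simp: bounded_iff)
  moreover have "g \<in> borel_measurable \<mu>"
    using borel_measurable_continuous_onI[OF assms(2)] by (simp add: measurable_cong_sets[OF sets])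
  ultimately show ?thesis by (intro integrable_const_bound[where B=B]) auto
qed

text \<open>The measure is the image under \<open>\<sigma>\<close> of a discrete distribution on the
  indices. Thus \<open>\<sigma>\<close> may repeat structures, and singletons of the structure space
  may fail to be Borel.\<close>

lemma finitely_supported_measure:
  fixes u :: "'i \<Rightarrow> real" and \<sigma> :: "'i \<Rightarrow> 's::topological_space"
  assumes I: "finite I" "\<And>i. i \<in> I \<Longrightarrow> 0 \<le> u i" "sum u I = 1"
  obtains \<mu> where "\<mu> \<in> borel_probs"
    "\<And>g :: 's \<Rightarrow> real. continuous_on UNIV g \<Longrightarrow> (LINT s|\<mu>. g s) = (\<Sum>i\<in>I. u i * g (\<sigma> i))"
proof -
  \<comment> \<open>A mass function lives on the whole index type, so \<open>u\<close> is extended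
    by zero outside \<open>I\<close>.\<close>
  define w where "w i = (if i \<in> I then u i else 0)" for i
  define P where "P = embed_pmf w"
  have "(\<integral>\<^sup>+i. ennreal (w i) \<partial>count_space UNIV) = (\<Sum>i\<in>I. ennreal (w i))"
    using I(1) by (intro nn_integral_count_space') (auto simp: w_def)
  also have "\<dots> = ennreal (sum u I)"
    using I(2) by (subst sum_ennreal) (auto simp: w_def cong: sum.cong)
  finally have P: "pmf P i = w i" for i
    unfolding P_def using I(2,3) by (intro pmf_embed_pmf) (auto simp: w_def)
  have meas: "\<sigma> \<in> measurable (measure_pmf P) borel" by simp
  show ?thesis
  proof
    show "distr (measure_pmf P) borel \<sigma> \<in> borel_probs"
      unfolding borel_probs_def using measure_pmf.prob_space_distr[OF meas] by simp
    fix g :: "'s \<Rightarrow> real" assume g: "continuous_on UNIV g"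
    have "(LINT s|distr (measure_pmf P) borel \<sigma>. g s) = (LINT i|measure_pmf P. g (\<sigma> i))"
      by (rule integral_distr[OF meas borel_measurable_continuous_onI[OF g]])
    also have "\<dots> = (\<Sum>i\<in>I. g (\<sigma> i) * pmf P i)"
      by (rule integral_measure_pmf_real) (use I(1) P in \<open>auto simp: set_pmf_eq w_def split: if_splits\<close>)
    also have "\<dots> = (\<Sum>i\<in>I. u i * g (\<sigma> i))"
      by (intro sum.cong) (auto simp: P w_def)
    finally show "(LINT s|distr (measure_pmf P) borel \<sigma>. g s) = (\<Sum>i\<in>I. u i * g (\<sigma> i))" .
  qed
qed

text \<open>The Borel sets need not separate points, so the mass of each atom is spread evenly over its
  points.\<close>

lemma finite_space_weights:
  fixes \<mu> :: "'s::topological_space measure"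
  assumes fin: "finite (UNIV :: 's set)" and \<mu>: "\<mu> \<in> borel_probs"
  obtains w where "\<And>s. 0 \<le> w s" "(\<Sum>s\<in>UNIV. w s) = 1"
    "\<And>g :: 's \<Rightarrow> real. continuous_on UNIV g \<Longrightarrow> (LINT s|\<mu>. g s) = (\<Sum>s\<in>UNIV. w s * g s)"
proof -
  \<comment> \<open>The smallest Borel set containing \<open>s\<close>: on a finite space this
    intersection is finite, hence Borel.\<close>
  define atom where "atom s = \<Inter>{A \<in> sets (borel :: 's measure). s \<in> A}" for s
  define w where "w s = measure \<mu> (atom s) / card (atom s)" for s
  interpret prob_space \<mu> using \<mu> by (simp add: borel_probs_def)
  have sets: "sets \<mu> = sets borel" using \<mu> by (simp add: borel_probs_def)
  have space: "space \<mu> = UNIV" using sets_eq_imp_space_eq[OF sets] by simp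
  have finf: "finite (A :: 's set)" for A using fin rev_finite_subset by blast
  have atom_self: "s \<in> atom s" for s by (auto simp: atom_def)
  have "finite {A \<in> sets (borel :: 's measure). s \<in> A}" for s
    by (rule finite_subset[OF subset_UNIV]) (simp add: Finite_Set.finite_set fin)
  moreover have "UNIV \<in> {A \<in> sets (borel :: 's measure). s \<in> A}" for s by simp
  ultimately have "(\<Inter>A\<in>{A \<in> sets (borel :: 's measure). s \<in> A}. A) \<in> sets borel" for s
    by (intro sets.finite_INT) blast+
  then have atom_borel: "atom s \<in> sets borel" for s by (simp add: atom_def)
  have atom_sub: "x \<in> atom s \<Longrightarrow> atom x \<subseteq> atom s" for x s
    using atom_borel by (auto simp: atom_def)
  have atom_sym: "s \<in> atom x" if "x \<in> atom s" for x s
  proof (rule ccontr)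
    assume "s \<notin> atom x"
    moreover have "- atom x \<in> sets borel" using atom_borel by (metis Compl_eq_Diff_UNIV sets.compl_sets space_borel)
    ultimately have "atom s \<subseteq> - atom x" by (auto simp: atom_def)
    with that atom_self show False by auto
  qed
  have atom_eq: "x \<in> atom s \<Longrightarrow> atom x = atom s" for x s
    using atom_sub atom_sym by blast
  have card_pos: "card (atom s) > 0" for s
    using atom_self finf by (auto simp: card_gt_0_iff)
  have w_int: "(LINT s|\<mu>. g s) = (\<Sum>s\<in>UNIV. w s * g s)" if g: "continuous_on UNIV g" for g :: "'s \<Rightarrow> real"
  proof -
    \<comment> \<open>Level sets of a continuous function are Borel, so each contains the whole atom
      of any of its points.\<close>
    have const: "g x = g s" if "x \<in> atom s" for x s
    proof -
      have "{x. g x = g s} \<in> sets borel"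
        using borel_measurable_continuous_onI[OF g] by measurable
      then have "atom s \<subseteq> {x. g x = g s}" by (auto simp: atom_def)
      with that show ?thesis by auto
    qed
    \<comment> \<open>Only the points of the atom of \<open>x\<close> contribute, each the same
      share \<open>g x / card (atom x)\<close>.\<close>
    have pt: "g x = (\<Sum>s\<in>UNIV. g s / card (atom s) * indicator (atom s) x)" for x
    proof -
      have "(\<Sum>s\<in>UNIV. g s / card (atom s) * indicator (atom s) x)
          = (\<Sum>s\<in>UNIV. if s \<in> atom x then g x / card (atom x) else 0)"
        using atom_sym atom_eq const by (intro sum.cong refl) (auto simp: indicator_def; metis)
      also have "\<dots> = g x" using card_pos[of x] fin by (simp add: sum.If_cases)
      finally show ?thesis by simp
    qed
    have atom_int: "integrable \<mu> (\<lambda>x. g s / card (atom s) * indicator (atom s) x)" for s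
      by (intro integrable_mult_right integrable_real_indicator) (auto simp: sets atom_borel less_top[symmetric])
    have "(LINT x|\<mu>. g x) = (LINT x|\<mu>. (\<Sum>s\<in>UNIV. g s / card (atom s) * indicator (atom s) x))"
      by (subst pt) (rule refl)
    also have "\<dots> = (\<Sum>s\<in>UNIV. g s / card (atom s) * measure \<mu> (atom s))"
      using atom_int by (subst Bochner_Integration.integral_sum) (auto simp: space)
    also have "\<dots> = (\<Sum>s\<in>UNIV. w s * g s)" by (simp add: w_def mult.commute)
    finally show ?thesis .
  qed
  show ?thesis
  proof
    show "0 \<le> w s" for s by (simp add: w_def)
    show "(\<Sum>s\<in>UNIV. w s) = 1" using w_int[of "\<lambda>_. 1"] by (simp add: prob_space)
  qed (rule w_int)
qed

section \<open>Subsequences and subgradients\<close>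

lemma convergent_subsequence_finite:
  fixes w :: "nat \<Rightarrow> 's \<Rightarrow> real"
  assumes "finite A" "\<And>n s. \<bar>w n s\<bar> \<le> B"
  shows "\<exists>r v. strict_mono (r :: nat \<Rightarrow> nat) \<and> (\<forall>s\<in>A. (\<lambda>n. w (r n) s) \<longlonglongrightarrow> v s)"
  using assms(1)
proof (induction A)
  case empty
  show ?case using strict_mono_id by auto
next
  case (insert a A)
  then obtain r v where r: "strict_mono (r :: nat \<Rightarrow> nat)" "\<forall>s\<in>A. (\<lambda>n. w (r n) s) \<longlonglongrightarrow> v s" by auto
  have "bounded (range (\<lambda>n. w (r n) a))" using assms(2) by (auto simp: bounded_iff)
  then obtain l r' where r': "strict_mono (r' :: nat \<Rightarrow> nat)" "(\<lambda>n. w (r (r' n)) a) \<longlonglongrightarrow> l"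
    using bounded_imp_convergent_subsequence[of "\<lambda>n. w (r n) a"] by (auto simp: o_def)
  have "(\<lambda>n. w (r (r' n)) s) \<longlonglongrightarrow> v s" if "s \<in> A" for s
    using LIMSEQ_subseq_LIMSEQ[OF r(2)[rule_format, OF that] r'(1)] by (simp add: o_def)
  then show ?case
    using r(1) r' insert.hyps
    by (intro exI[of _ "r \<circ> r'"] exI[of _ "v(a := l)"]) (auto simp: strict_mono_def)
qed

text \<open>A hyperplane separating the ray \<open>R\<close> of slope \<open>c\<close> from the
  strict epigraph \<open>E\<close> yields one subgradient whose slope along \<open>v\<close> is at
  least \<open>c\<close>. Taking \<open>v\<close> and \<open>c\<close> zero gives plain existence of
  a subgradient.\<close>

lemma ex_subgradient:
  fixes f :: "'a::euclidean_space \<Rightarrow> real"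
  assumes conv: "convex_on UNIV f" and slope: "\<And>t. t \<ge> 0 \<Longrightarrow> f \<alpha> + t * c \<le> f (\<alpha> + t *\<^sub>R v)"
  obtains g where "\<forall>\<beta>. f \<alpha> + g \<bullet> (\<beta> - \<alpha>) \<le> f \<beta>" "c \<le> g \<bullet> v"
proof -
  define R where "R = (\<lambda>t. (\<alpha> + t *\<^sub>R v, f \<alpha> + t * c)) ` {0..}"
  define E where "E = {z. f (fst z) < snd z}"
  have "R = (\<lambda>z. (\<alpha>, f \<alpha>) + z) ` ((\<lambda>t. t *\<^sub>R (v, c)) ` {0..})"
    by (auto simp: R_def image_image)
  moreover have "convex ((\<lambda>t. t *\<^sub>R (v, c)) ` {0::real..})"
    by (intro convex_linear_image) (auto intro!: bounded_linear.linear bounded_linear_intros)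
  ultimately have cR: "convex R" by (simp add: convex_translation)
  have cE: "convex E"
  proof (rule convexI)
    fix x y :: "'a \<times> real" and a b :: real
    assume xy: "x \<in> E" "y \<in> E" and ab: "0 \<le> a" "0 \<le> b" "a + b = 1"
    have "f (a *\<^sub>R fst x + b *\<^sub>R fst y) \<le> a * f (fst x) + b * f (fst y)"
      using conv ab by (auto simp: convex_on_def)
    also have "\<dots> < a * snd x + b * snd y"
    proof (cases "a = 0")
      case True then show ?thesis using xy ab by (simp add: E_def)
    next
      case False
      then have "a * f (fst x) < a * snd x" using xy ab by (simp add: E_def)
      moreover have "b * f (fst y) \<le> b * snd y" using xy ab by (simp add: E_def mult_left_mono)
      ultimately show ?thesis by linarith
    qed
    finally show "a *\<^sub>R x + b *\<^sub>R y \<in> E" by (simp add: E_def)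
  qed
  have "(\<alpha>, f \<alpha> + 1) \<in> E" "(\<alpha>, f \<alpha>) \<in> R" by (auto simp: E_def R_def intro: rev_image_eqI[of 0])
  moreover have "R \<inter> E = {}" using slope by (fastforce simp: R_def E_def)
  ultimately obtain a b where ab: "a \<noteq> 0" "\<forall>z\<in>R. a \<bullet> z \<le> b" "\<forall>z\<in>E. a \<bullet> z \<ge> b"
    using separating_hyperplane_sets[OF cR cE] by blast
  obtain p q where a: "a = (p, q)" by fastforce
  have R: "p \<bullet> (\<alpha> + t *\<^sub>R v) + q * (f \<alpha> + t * c) \<le> b" if "t \<ge> 0" for t
    using ab(2) that by (auto simp: R_def a)
  have E: "b \<le> p \<bullet> \<beta> + q * r" if "f \<beta> < r" for \<beta> r
    using ab(3) that by (auto simp: E_def a)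
  \<comment> \<open>The epigraph is unbounded upwards, so a negative \<open>q\<close> would push the
    pairing below \<open>b\<close>.\<close>
  have q0: "q \<ge> 0"
  proof (rule ccontr)
    assume "\<not> q \<ge> 0"
    define r where "r = max (f \<alpha> + 1) ((b - 1 - p \<bullet> \<alpha>) / q)"
    have "q * r \<le> q * ((b - 1 - p \<bullet> \<alpha>) / q)"
      using \<open>\<not> q \<ge> 0\<close> by (intro mult_left_mono_neg) (auto simp: r_def)
    then have "q * r \<le> b - 1 - p \<bullet> \<alpha>" using \<open>\<not> q \<ge> 0\<close> by simp
    moreover have "b \<le> p \<bullet> \<alpha> + q * r" by (rule E) (simp add: r_def)
    ultimately show False by linarith
  qed
  \<comment> \<open>A vertical hyperplane is excluded because \<open>f\<close> is finite everywhere: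
    a point far enough in direction \<open>- p\<close> lies on the wrong side.\<close>
  have "q \<noteq> 0"
  proof
    assume q: "q = 0"
    then have p: "p \<noteq> 0" using ab(1) a by (simp add: zero_prod_def)
    define k where "k = (\<bar>b\<bar> + 1) / (p \<bullet> p)"
    have "b \<le> p \<bullet> (- k *\<^sub>R p)" using E[of "- k *\<^sub>R p" "f (- k *\<^sub>R p) + 1"] q by simp
    also have "\<dots> = - (\<bar>b\<bar> + 1)" using p by (simp add: k_def)
    finally show False by linarith
  qed
  with q0 have q: "q > 0" by simp
  have le: "b \<le> p \<bullet> \<beta> + q * f \<beta>" for \<beta>
  proof (rule field_le_epsilon)
    fix e :: real assume "e > 0"
    then show "b \<le> p \<bullet> \<beta> + q * f \<beta> + e"
      using E[of \<beta> "f \<beta> + e / q"] q by (simp add: algebra_simps)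
  qed
  \<comment> \<open>The ray starts on the graph, so its starting point meets both bounds and lies on
    the hyperplane; dividing by \<open>q\<close> then gives the slope
    \<open>- p / q\<close>.\<close>
  have \<alpha>: "p \<bullet> \<alpha> + q * f \<alpha> = b" using R[of 0] le[of \<alpha>] by simp
  show ?thesis
  proof
    show "\<forall>\<beta>. f \<alpha> + (- (1 / q) *\<^sub>R p) \<bullet> (\<beta> - \<alpha>) \<le> f \<beta>"
    proof
      fix \<beta>
      show "f \<alpha> + (- (1 / q) *\<^sub>R p) \<bullet> (\<beta> - \<alpha>) \<le> f \<beta>"
        using le[of \<beta>] \<alpha> q by (simp add: field_simps inner_diff_right)
    qed
  next
    show "c \<le> (- (1 / q) *\<^sub>R p) \<bullet> v"
      using R[of 1] \<alpha> q by (simp add: field_simps inner_add_right)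
  qed
qed

subsection \<open>Consistency and uniform surrogate gaps\<close>

text \<open>Common ground of both cases. \<open>range L\<close> is a set of functions on the
  structures, so \<open>finite_losses\<close> says that only finitely many loss profiles
  \<open>L \<alpha>\<close> occur.\<close>

locale surrogate_setting =
  fixes L \<phi> :: "'a::euclidean_space \<Rightarrow> 's::topological_space \<Rightarrow> real"
  assumes compact_structures: "compact (UNIV :: 's set)"
    and finite_losses: "finite (range L)"
    and L_bounds: "0 \<le> L \<alpha> s" "L \<alpha> s \<le> 1"
    and L_cont: "continuous_on UNIV (L \<alpha>)"
    and surr_nonneg: "0 \<le> \<phi> \<alpha> s"
    and surr_cont: "continuous_on UNIV (\<phi> \<alpha>)"
begin

text \<open>The witnesses \<open>\<beta>\<close> and \<open>\<gamma>\<close> stand in for infima,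
  which keeps the condition in the reals; the point is that \<open>h\<close> is the same for every
  measure and score.\<close>

definition surrogate_gap :: "real \<Rightarrow> real \<Rightarrow> bool" where
  "surrogate_gap \<epsilon> h \<longleftrightarrow> (\<forall>\<mu>\<in>borel_probs. \<forall>\<alpha> \<beta>. cond_risk L \<beta> \<mu> + \<epsilon> \<le> cond_risk L \<alpha> \<mu> \<longrightarrow>
     (\<exists>\<gamma>. cond_risk \<phi> \<gamma> \<mu> + h \<le> cond_risk \<phi> \<alpha> \<mu>))"

section \<open>Conditional risks as real numbers and their minimisers\<close>

lemma integrable_cont: "continuous_on UNIV g \<Longrightarrow> \<mu> \<in> borel_probs \<Longrightarrow> integrable \<mu> (g :: 's \<Rightarrow> real)"
  using integrable_borel_probs[OF compact_structures] by blast

text \<open>Continuous losses on a compact space are integrable for every Borel probability measure,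
  so the closure is taken of the full set.\<close>

lemma measure_class_eq: "measure_class L = borel_probs"
proof -
  have "{\<mu> \<in> borel_probs. \<forall>\<alpha>. integrable \<mu> (L \<alpha>)} = borel_probs"
    using integrable_cont L_cont by auto
  moreover have "weak_closure borel_probs = (borel_probs :: 's measure set)"
    unfolding weak_closure_def by force
  ultimately show ?thesis by (simp add: measure_class_def)
qed

lemma cond_surr_eq: "\<mu> \<in> borel_probs \<Longrightarrow> cond_surr \<phi> \<alpha> \<mu> = ennreal (cond_risk \<phi> \<alpha> \<mu>)"
  unfolding cond_surr_def cond_risk_def
  using integrable_cont[OF surr_cont] surr_nonneg by (intro nn_integral_eq_integral) auto

lemma cond_risk_surr_nonneg: "0 \<le> cond_risk \<phi> \<alpha> \<mu>"
  unfolding cond_risk_def using surr_nonneg by (intro integral_nonneg_AE) auto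

lemma cond_risk_L_bounds:
  assumes "\<mu> \<in> borel_probs"
  shows "0 \<le> cond_risk L \<alpha> \<mu>" "cond_risk L \<alpha> \<mu> \<le> 1"
proof -
  interpret prob_space \<mu> using assms by (simp add: borel_probs_def)
  show "0 \<le> cond_risk L \<alpha> \<mu>"
    unfolding cond_risk_def using L_bounds by (intro integral_nonneg_AE) auto
  have "cond_risk L \<alpha> \<mu> \<le> (LINT s|\<mu>. 1)"
    unfolding cond_risk_def using L_bounds integrable_cont[OF L_cont assms]
    by (intro integral_mono) auto
  then show "cond_risk L \<alpha> \<mu> \<le> 1" by (simp add: prob_space)
qed

lemma finite_cond_risks: "finite (range (\<lambda>\<alpha>. cond_risk L \<alpha> \<mu>))"
proof -
  have "range (\<lambda>\<alpha>. cond_risk L \<alpha> \<mu>) = (\<lambda>l. LINT s|\<mu>. l s) ` range L"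
    by (auto simp: cond_risk_def)
  with finite_losses show ?thesis by simp
qed

lemma ex_argmin: "\<exists>\<beta>. \<forall>\<alpha>. cond_risk L \<beta> \<mu> \<le> cond_risk L \<alpha> \<mu>"
proof -
  have "Min (range (\<lambda>\<alpha>. cond_risk L \<alpha> \<mu>)) \<in> range (\<lambda>\<alpha>. cond_risk L \<alpha> \<mu>)"
    using finite_cond_risks by (intro Min_in) auto
  then obtain \<beta> where "cond_risk L \<beta> \<mu> = Min (range (\<lambda>\<alpha>. cond_risk L \<alpha> \<mu>))" by auto
  then have "\<forall>\<alpha>. cond_risk L \<beta> \<mu> \<le> cond_risk L \<alpha> \<mu>"
    using finite_cond_risks[of \<mu>] by simp
  then show ?thesis ..
qed

text \<open>Turns the strict inequality between two extended infima into a real margin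
  \<open>h\<close> above the surrogate risk of a single score \<open>\<beta>\<close>.\<close>

lemma structure_consistent_gap:
  assumes "structure_consistent L \<phi>" "\<mu> \<in> borel_probs"
  obtains \<beta> h where "h > 0"
    "\<And>\<alpha> \<gamma>. cond_risk L \<gamma> \<mu> < cond_risk L \<alpha> \<mu> \<Longrightarrow> cond_risk \<phi> \<beta> \<mu> + h \<le> cond_risk \<phi> \<alpha> \<mu>"
proof -
  let ?N = "{\<alpha>. \<not> is_arg_min (\<lambda>\<alpha>'. cond_risk L \<alpha>' \<mu>) (\<lambda>_. True) \<alpha>}"
  from assms have "(INF \<alpha>. cond_surr \<phi> \<alpha> \<mu>) < (INF \<alpha>\<in>?N. cond_surr \<phi> \<alpha> \<mu>)"
    by (auto simp: structure_consistent_def measure_class_eq)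
  then obtain \<beta> where "cond_surr \<phi> \<beta> \<mu> < (INF \<alpha>\<in>?N. cond_surr \<phi> \<alpha> \<mu>)"
    by (auto simp: INF_less_iff)
  \<comment> \<open>The intermediate value \<open>c\<close> is finite even if the right-hand infimum
    is infinite, as happens when every score is a minimiser.\<close>
  then obtain c where c: "cond_surr \<phi> \<beta> \<mu> < c" "c < (INF \<alpha>\<in>?N. cond_surr \<phi> \<alpha> \<mu>)"
    using dense by blast
  then obtain c' where c': "c = ennreal c'" "c' \<ge> 0"
    by (cases c) auto
  show ?thesis
  proof
    show "c' - cond_risk \<phi> \<beta> \<mu> > 0"
      using c(1) c' cond_risk_surr_nonneg by (simp add: cond_surr_eq[OF assms(2)] ennreal_less_iff)
    fix \<alpha> \<gamma> assume "cond_risk L \<gamma> \<mu> < cond_risk L \<alpha> \<mu>"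
    then have "\<alpha> \<in> ?N" by (auto simp: is_arg_min_def)
    then have "c \<le> cond_surr \<phi> \<alpha> \<mu>" using c(2) INF_lower[of \<alpha> ?N "\<lambda>\<alpha>. cond_surr \<phi> \<alpha> \<mu>"]
      by (meson less_imp_le order_trans)
    then show "cond_risk \<phi> \<beta> \<mu> + (c' - cond_risk \<phi> \<beta> \<mu>) \<le> cond_risk \<phi> \<alpha> \<mu>"
      using c' cond_risk_surr_nonneg by (simp add: cond_surr_eq[OF assms(2)])
  qed
qed

section \<open>Total surrogate risk; from Fisher consistency to structure consistency\<close>

lemma surr_risk_eq:
  assumes "\<And>q. q \<in> Q \<Longrightarrow> \<mu> q \<in> borel_probs" "\<And>q. q \<in> Q \<Longrightarrow> 0 \<le> p q"
  shows "surr_risk Q \<phi> p \<mu> f = (\<Sum>\<^sub>\<infinity>q\<in>Q. ennreal (p q * cond_risk \<phi> (f q) (\<mu> q)))"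
proof -
  have "\<forall>q\<in>Q. integrable (\<mu> q) (\<phi> (f q))" using assms integrable_cont[OF surr_cont] by blast
  then show ?thesis
    unfolding surr_risk_def using assms cond_risk_surr_nonneg
    by (auto intro!: infsum_cong simp: cond_surr_eq ennreal_mult)
qed

lemma fisher_imp_structure_consistent:
  fixes Q :: "'q set"
  assumes "Q \<noteq> {}" and FC: "fisher_consistent Q L \<phi>"
  shows "structure_consistent L \<phi>"
proof (rule ccontr)
  assume "\<not> structure_consistent L \<phi>"
  then obtain \<mu> where \<mu>: "\<mu> \<in> borel_probs" and
    le: "(INF \<alpha> \<in> {\<alpha>. \<not> is_arg_min (\<lambda>\<alpha>'. cond_risk L \<alpha>' \<mu>) (\<lambda>_. True) \<alpha>}. cond_surr \<phi> \<alpha> \<mu>)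
      \<le> (INF \<alpha>. cond_surr \<phi> \<alpha> \<mu>)" (is "(INF \<alpha>\<in>?N. _) \<le> ?m")
    unfolding structure_consistent_def measure_class_eq by (auto simp: not_less)
  \<comment> \<open>Finiteness of the infimum makes \<open>?m + 1 / Suc n\<close> strictly larger
    than \<open>?m\<close>, so near-optimal non-minimisers can be selected.\<close>
  have m: "?m \<noteq> \<top>"
    using INF_lower[of undefined UNIV "\<lambda>\<alpha>. cond_surr \<phi> \<alpha> \<mu>"] cond_surr_eq[OF \<mu>]
    by (metis UNIV_I ennreal_neq_top top.extremum_unique)
  have "\<exists>\<alpha>\<in>?N. cond_surr \<phi> \<alpha> \<mu> < ?m + ennreal (1 / Suc n)" for n
  proof -
    have "(INF \<alpha>\<in>?N. cond_surr \<phi> \<alpha> \<mu>) < ?m + ennreal (1 / Suc n)"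
      using le m by (intro le_less_trans[OF le]) (simp add: ennreal_zero_less_divide less_top ennreal_add_left_cancel_less)
    then show ?thesis by (auto simp: INF_less_iff)
  qed
  then obtain \<alpha> where \<alpha>: "\<And>n. \<alpha> n \<in> ?N" "\<And>n. cond_surr \<phi> (\<alpha> n) \<mu> < ?m + ennreal (1 / Suc n)"
    by metis
  obtain q0 where q0: "q0 \<in> Q" using \<open>Q \<noteq> {}\<close> by blast
  define p where "p q = (if q = q0 then 1 else 0 :: real)" for q
  have has_sum: "(p has_sum 1) Q"
    by (rule has_sum_finite_neutralI[of "{q0}"]) (use q0 in \<open>auto simp: p_def\<close>)
  then have qd: "query_data Q L p (\<lambda>_. \<mu>)"
    using \<mu> by (auto simp: query_data_def measure_class_eq p_def)
  have surr: "surr_risk Q \<phi> p (\<lambda>_. \<mu>) f = cond_surr \<phi> (f q0) \<mu>" for f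
  proof -
    have "(\<Sum>\<^sub>\<infinity>q\<in>Q. ennreal (p q * cond_risk \<phi> (f q) \<mu>)) = (\<Sum>\<^sub>\<infinity>q\<in>{q0}. ennreal (p q * cond_risk \<phi> (f q) \<mu>))"
      by (rule infsum_cong_neutral) (use q0 in \<open>auto simp: p_def\<close>)
    with \<mu> show ?thesis by (subst surr_risk_eq) (auto simp: p_def cond_surr_eq)
  qed
  have risk: "risk Q L p (\<lambda>_. \<mu>) f = cond_risk L (f q0) \<mu>" for f
  proof -
    have "(\<Sum>\<^sub>\<infinity>q\<in>Q. p q * cond_risk L (f q) \<mu>) = (\<Sum>\<^sub>\<infinity>q\<in>{q0}. p q * cond_risk L (f q) \<mu>)"
      by (rule infsum_cong_neutral) (use q0 in \<open>auto simp: p_def\<close>)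
    then show ?thesis by (simp add: risk_def p_def)
  qed
  \<comment> \<open>Evaluation at \<open>q0\<close> is onto, so infima over scorers become infima
    over scores.\<close>
  have "\<alpha> \<in> range (\<lambda>f :: 'q \<Rightarrow> 'a. f q0)" for \<alpha>
    by (rule range_eqI[of _ _ "\<lambda>_. \<alpha>"]) simp
  then have range: "range (\<lambda>f :: 'q \<Rightarrow> 'a. f q0) = UNIV" by blast
  have opt_surr: "opt_surr_risk Q \<phi> p (\<lambda>_. \<mu>) = ?m"
    unfolding opt_surr_risk_def scorers_eq_UNIV surr
    by (subst range[symmetric]) (simp only: image_image)
  have opt: "opt_risk Q L p (\<lambda>_. \<mu>) = (INF \<alpha>. cond_risk L \<alpha> \<mu>)"
    unfolding opt_risk_def scorers_eq_UNIV risk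
    by (subst range[symmetric]) (simp only: image_image)
  define m where "m = ?m"
  have m_le: "m \<le> cond_surr \<phi> \<alpha>' \<mu>" for \<alpha>'
    unfolding m_def by (rule INF_lower) simp
  have "(\<lambda>n. m + ennreal (1 / Suc n)) \<longlonglongrightarrow> m + ennreal 0"
    by (intro tendsto_add tendsto_const tendsto_ennrealI LIMSEQ_Suc[OF lim_1_over_n])
  then have up: "(\<lambda>n. m + ennreal (1 / Suc n)) \<longlonglongrightarrow> m" by simp
  have "(\<lambda>n. cond_surr \<phi> (\<alpha> n) \<mu>) \<longlonglongrightarrow> m"
  proof (rule tendsto_sandwich[OF _ _ tendsto_const up])
    show "\<forall>\<^sub>F n in sequentially. m \<le> cond_surr \<phi> (\<alpha> n) \<mu>" using m_le by simp
    show "\<forall>\<^sub>F n in sequentially. cond_surr \<phi> (\<alpha> n) \<mu> \<le> m + ennreal (1 / Suc n)"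
      using \<alpha>(2) unfolding m_def by (intro always_eventually allI less_imp_le)
  qed
  then have "(\<lambda>n. surr_risk Q \<phi> p (\<lambda>_. \<mu>) (\<lambda>_. \<alpha> n)) \<longlonglongrightarrow> opt_surr_risk Q \<phi> p (\<lambda>_. \<mu>)"
    unfolding surr opt_surr m_def .
  then have "(\<lambda>n. risk Q L p (\<lambda>_. \<mu>) (\<lambda>_. \<alpha> n)) \<longlonglongrightarrow> opt_risk Q L p (\<lambda>_. \<mu>)"
    by (intro FC[unfolded fisher_consistent_def scorers_eq_UNIV, rule_format, OF qd]) simp_all
  then have lim: "(\<lambda>n. cond_risk L (\<alpha> n) \<mu>) \<longlonglongrightarrow> (INF \<alpha>. cond_risk L \<alpha> \<mu>)"
    unfolding risk opt .
  \<comment> \<open>Finitely many conditional risks form a closed set, so the limit is attained by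
    some \<open>\<alpha> n\<close>, which is then a minimiser despite being chosen from
    \<open>?N\<close>.\<close>
  have "closed (range (\<lambda>n. cond_risk L (\<alpha> n) \<mu>))"
    by (intro finite_imp_closed finite_subset[OF _ finite_cond_risks[of \<mu>]]) auto
  then have "(INF \<alpha>. cond_risk L \<alpha> \<mu>) \<in> range (\<lambda>n. cond_risk L (\<alpha> n) \<mu>)"
    by (rule closed_sequentially[OF _ _ lim]) auto
  then obtain n where n: "cond_risk L (\<alpha> n) \<mu> = (INF \<alpha>. cond_risk L \<alpha> \<mu>)" by auto
  have "cond_risk L (\<alpha> n) \<mu> \<le> cond_risk L \<beta> \<mu>" for \<beta>
    unfolding n using finite_cond_risks by (intro cINF_lower bdd_below_finite) auto
  then show False using \<alpha>(1)[of n] by (auto simp: is_arg_min_def not_less)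
qed

section \<open>From a uniform surrogate gap to uniform Fisher consistency\<close>

lemma uniformly_fisher_consistentI:
  fixes Q :: "'q set"
  assumes finite_opt: "\<And>p \<mu>. query_data Q L p \<mu> \<Longrightarrow> \<exists>f\<in>scorers Q. surr_risk Q \<phi> p \<mu> f < \<infinity>"
    and gap: "\<And>\<epsilon>. \<epsilon> > 0 \<Longrightarrow> \<exists>h>0. surrogate_gap \<epsilon> h"
  shows "uniformly_fisher_consistent Q L \<phi>"
  unfolding uniformly_fisher_consistent_def
proof (intro allI impI)
  fix \<epsilon> :: real assume "\<epsilon> > 0"
  \<comment> \<open>One half of \<open>\<epsilon>\<close> pays for the good queries, the other half
    for the mass of the bad ones. The resulting \<open>\<delta>\<close> is \<open>h\<close> times
    that second half.\<close>
  then obtain h where h: "h > 0" "surrogate_gap (\<epsilon> / 2) h" using gap[of "\<epsilon> / 2"] by auto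
  show "\<exists>\<delta>>0. \<forall>p \<mu>. query_data Q L p \<mu> \<longrightarrow> (\<forall>f \<in> scorers Q.
         surr_risk Q \<phi> p \<mu> f < opt_surr_risk Q \<phi> p \<mu> + ennreal \<delta> \<longrightarrow>
         risk Q L p \<mu> f < opt_risk Q L p \<mu> + \<epsilon>)"
  proof (intro exI[of _ "h * (\<epsilon> / 2)"] conjI allI impI ballI)
    show "h * (\<epsilon> / 2) > 0" using h \<open>\<epsilon> > 0\<close> by simp
  next
    fix p and \<mu> :: "'q \<Rightarrow> 's measure" and f :: "'q \<Rightarrow> 'a"
    assume qd: "query_data Q L p \<mu>"
      and near: "surr_risk Q \<phi> p \<mu> f < opt_surr_risk Q \<phi> p \<mu> + ennreal (h * (\<epsilon> / 2))"
    have p: "\<And>q. q \<in> Q \<Longrightarrow> 0 \<le> p q" "(p has_sum 1) Q" and \<mu>: "\<And>q. q \<in> Q \<Longrightarrow> \<mu> q \<in> borel_probs"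
      using qd by (auto simp: query_data_def measure_class_eq)
    have p_sum: "p summable_on Q" "infsum p Q = 1"
      using p(2) by (auto simp: summable_on_def infsumI)
    obtain b where b: "\<And>q \<alpha>. cond_risk L (b q) (\<mu> q) \<le> cond_risk L \<alpha> (\<mu> q)"
      using choice[of "\<lambda>q \<beta>. \<forall>\<alpha>. cond_risk L \<beta> (\<mu> q) \<le> cond_risk L \<alpha> (\<mu> q)"] ex_argmin by blast
    define bad where "bad q \<longleftrightarrow> cond_risk L (b q) (\<mu> q) + \<epsilon> / 2 \<le> cond_risk L (f q) (\<mu> q)" for q
    define e where "e q = p q * of_bool (bad q)" for q
    \<comment> \<open>At a good query the old score \<open>f q\<close> already serves as
      \<open>\<gamma>\<close>.\<close>
    have "\<exists>\<gamma>. cond_risk \<phi> \<gamma> (\<mu> q) + h * of_bool (bad q) \<le> cond_risk \<phi> (f q) (\<mu> q)" if "q \<in> Q" for q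
      using h(2) \<mu>[OF that] unfolding surrogate_gap_def bad_def by (cases "bad q") (auto simp: bad_def)
    then obtain g where g: "\<And>q. q \<in> Q \<Longrightarrow> cond_risk \<phi> (g q) (\<mu> q) + h * of_bool (bad q) \<le> cond_risk \<phi> (f q) (\<mu> q)"
      by metis
    have e: "0 \<le> e q" "e q \<le> p q" if "q \<in> Q" for q using p(1)[OF that] by (auto simp: e_def)
    have e_sum: "e summable_on Q" by (rule summable_on_comparison_test[OF p_sum(1)]) (use e in auto)
    have L_sum: "(\<lambda>q. p q * cond_risk L (k q) (\<mu> q)) summable_on Q" for k
      by (rule summable_on_comparison_test[OF p_sum(1)])
        (use p(1) \<mu> cond_risk_L_bounds in \<open>auto intro: mult_right_le_one_le\<close>)
    \<comment> \<open>The comparison is carried out in extended reals because the surrogate sums may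
      diverge; \<open>infsum e Q\<close> is the mass of the bad queries.\<close>
    have "opt_surr_risk Q \<phi> p \<mu> + ennreal (h * infsum e Q)
        \<le> surr_risk Q \<phi> p \<mu> g + ennreal (infsum (\<lambda>q. h * e q) Q)"
      by (auto simp: opt_surr_risk_def scorers_eq_UNIV infsum_cmult_right' intro!: add_mono INF_lower)
    also have "\<dots> = (\<Sum>\<^sub>\<infinity>q\<in>Q. ennreal (p q * cond_risk \<phi> (g q) (\<mu> q))) + (\<Sum>\<^sub>\<infinity>q\<in>Q. ennreal (h * e q))"
      using p \<mu> e e_sum h by (subst infsum_ennreal) (auto simp: surr_risk_eq intro!: summable_on_cmult_right)
    also have "\<dots> = (\<Sum>\<^sub>\<infinity>q\<in>Q. ennreal (p q * cond_risk \<phi> (g q) (\<mu> q)) + ennreal (h * e q))"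
      by (intro infsum_add[symmetric] nonneg_summable_on_complete) simp_all
    also have "\<dots> \<le> (\<Sum>\<^sub>\<infinity>q\<in>Q. ennreal (p q * cond_risk \<phi> (f q) (\<mu> q)))"
    proof (rule infsum_mono)
      fix q assume q: "q \<in> Q"
      have "p q * cond_risk \<phi> (g q) (\<mu> q) + h * e q \<le> p q * cond_risk \<phi> (f q) (\<mu> q)"
        using mult_left_mono[OF g[OF q] p(1)[OF q]] by (simp add: e_def algebra_simps)
      then show "ennreal (p q * cond_risk \<phi> (g q) (\<mu> q)) + ennreal (h * e q)
          \<le> ennreal (p q * cond_risk \<phi> (f q) (\<mu> q))"
        using p(1)[OF q] e(1)[OF q] h(1) cond_risk_surr_nonneg
        by (simp add: ennreal_leI flip: ennreal_plus)
    qed (intro nonneg_summable_on_complete; simp)+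
    also have "\<dots> = surr_risk Q \<phi> p \<mu> f" using p \<mu> by (simp add: surr_risk_eq)
    also note near
    finally have "opt_surr_risk Q \<phi> p \<mu> + ennreal (h * infsum e Q) < opt_surr_risk Q \<phi> p \<mu> + ennreal (h * (\<epsilon> / 2))" .
    \<comment> \<open>A finite optimum can be cancelled from both sides, leaving a bound on the bad
      mass alone.\<close>
    moreover have "opt_surr_risk Q \<phi> p \<mu> \<noteq> \<top>"
      using finite_opt[OF qd] unfolding opt_surr_risk_def
      by (metis INF_lower infinity_ennreal_def leD top.not_eq_extremum)
    moreover have "0 \<le> infsum e Q" using e by (intro infsum_nonneg) auto
    ultimately have "h * infsum e Q < h * (\<epsilon> / 2)"
      using h by (simp add: ennreal_add_left_cancel_less ennreal_less_iff)
    then have P: "infsum e Q < \<epsilon> / 2" using h(1) by (simp only: mult_less_cancel_left_pos)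
    have half_sum: "(\<lambda>q. p q * (\<epsilon> / 2)) summable_on Q"
      by (intro summable_on_cmult_left p_sum)
    have "risk Q L p \<mu> f \<le> (\<Sum>\<^sub>\<infinity>q\<in>Q. p q * cond_risk L (b q) (\<mu> q) + (p q * (\<epsilon> / 2) + e q))"
      unfolding risk_def
    proof (rule infsum_mono)
      fix q assume q: "q \<in> Q"
      \<comment> \<open>At a bad query the excess is bounded by 1, since the loss takes values in
        the unit interval.\<close>
      have "cond_risk L (f q) (\<mu> q) \<le> cond_risk L (b q) (\<mu> q) + (\<epsilon> / 2 + of_bool (bad q))"
        using cond_risk_L_bounds[OF \<mu>[OF q], of "f q"] cond_risk_L_bounds[OF \<mu>[OF q], of "b q"] \<open>\<epsilon> > 0\<close>
        by (cases "bad q") (auto simp: bad_def)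
      from mult_left_mono[OF this p(1)[OF q]]
      show "p q * cond_risk L (f q) (\<mu> q) \<le> p q * cond_risk L (b q) (\<mu> q) + (p q * (\<epsilon> / 2) + e q)"
        by (simp add: e_def algebra_simps)
    qed (intro L_sum summable_on_add half_sum e_sum)+
    also have "\<dots> = risk Q L p \<mu> b + (\<epsilon> / 2 + infsum e Q)"
      unfolding risk_def
      by (subst infsum_add[OF L_sum summable_on_add[OF half_sum e_sum]], subst infsum_add[OF half_sum e_sum])
        (simp only: infsum_cmult_left' p_sum(2) mult_1)
    also have "\<dots> < risk Q L p \<mu> b + \<epsilon>" using P by simp
    also have "risk Q L p \<mu> b \<le> opt_risk Q L p \<mu>"
      unfolding opt_risk_def scorers_eq_UNIV risk_def
      using p(1) b L_sum by (intro cINF_greatest infsum_mono mult_left_mono) auto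
    finally show "risk Q L p \<mu> f < opt_risk Q L p \<mu> + \<epsilon>" by simp
  qed
qed

text \<open>Finitely many pairs of loss profiles occur, so a gap for each pair gives a common one by
  taking the minimum.\<close>

lemma ex_surrogate_gapI:
  assumes "\<epsilon> > 0"
    and pair: "\<And>a b. a \<in> range L \<Longrightarrow> b \<in> range L \<Longrightarrow> \<exists>h>0. \<forall>\<mu>\<in>borel_probs. \<forall>\<alpha>.
      L \<alpha> = a \<and> \<epsilon> \<le> (LINT s|\<mu>. a s - b s) \<longrightarrow> (\<exists>\<gamma>. cond_risk \<phi> \<gamma> \<mu> + h \<le> cond_risk \<phi> \<alpha> \<mu>)"
  shows "\<exists>h>0. surrogate_gap \<epsilon> h"
proof -
  have "\<exists>h>0. \<forall>(a, b)\<in>range L \<times> range L. \<forall>\<mu>\<in>borel_probs. \<forall>\<alpha>.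
      L \<alpha> = a \<and> \<epsilon> \<le> (LINT s|\<mu>. a s - b s) \<longrightarrow> (\<exists>\<gamma>. cond_risk \<phi> \<gamma> \<mu> + h \<le> cond_risk \<phi> \<alpha> \<mu>)"
    unfolding case_prod_unfold
  proof (rule finite_uniform_positive)
    show "finite (range L \<times> range L)" using finite_losses by simp
  next
    fix x assume "x \<in> range L \<times> range L"
    then show "\<exists>h>0. \<forall>\<mu>\<in>borel_probs. \<forall>\<alpha>. L \<alpha> = fst x \<and> \<epsilon> \<le> (LINT s|\<mu>. fst x s - snd x s) \<longrightarrow>
        (\<exists>\<gamma>. cond_risk \<phi> \<gamma> \<mu> + h \<le> cond_risk \<phi> \<alpha> \<mu>)"
      by (intro pair) auto
  next
    fix x :: "('s \<Rightarrow> real) \<times> ('s \<Rightarrow> real)" and h h' :: real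
    assume *: "\<forall>\<mu>\<in>borel_probs. \<forall>\<alpha>. L \<alpha> = fst x \<and> \<epsilon> \<le> (LINT s|\<mu>. fst x s - snd x s) \<longrightarrow>
        (\<exists>\<gamma>. cond_risk \<phi> \<gamma> \<mu> + h \<le> cond_risk \<phi> \<alpha> \<mu>)" and "h' \<le> h"
    then have "\<And>c d. c + h \<le> d \<Longrightarrow> c + h' \<le> d" by simp
    with * show "\<forall>\<mu>\<in>borel_probs. \<forall>\<alpha>. L \<alpha> = fst x \<and> \<epsilon> \<le> (LINT s|\<mu>. fst x s - snd x s) \<longrightarrow>
        (\<exists>\<gamma>. cond_risk \<phi> \<gamma> \<mu> + h' \<le> cond_risk \<phi> \<alpha> \<mu>)" by meson
  qed
  then obtain h where h: "h > 0" "\<And>a b \<mu> \<alpha>. a \<in> range L \<Longrightarrow> b \<in> range L \<Longrightarrow> \<mu> \<in> borel_probs \<Longrightarrow>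
      L \<alpha> = a \<Longrightarrow> \<epsilon> \<le> (LINT s|\<mu>. a s - b s) \<Longrightarrow> \<exists>\<gamma>. cond_risk \<phi> \<gamma> \<mu> + h \<le> cond_risk \<phi> \<alpha> \<mu>"
    by fast
  have "surrogate_gap \<epsilon> h"
    unfolding surrogate_gap_def
  proof (intro ballI allI impI)
    fix \<mu> \<alpha> \<beta> assume \<mu>: "\<mu> \<in> borel_probs" and "cond_risk L \<beta> \<mu> + \<epsilon> \<le> cond_risk L \<alpha> \<mu>"
    then have "\<epsilon> \<le> (LINT s|\<mu>. L \<alpha> s - L \<beta> s)"
      using integrable_cont[OF L_cont \<mu>] by (simp add: cond_risk_def)
    then show "\<exists>\<gamma>. cond_risk \<phi> \<gamma> \<mu> + h \<le> cond_risk \<phi> \<alpha> \<mu>" using h(2) \<mu> by blast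
  qed
  with h(1) show ?thesis by blast
qed

text \<open>Failure of the gap for a fixed pair of profiles is tested at
  \<open>h = 1 / Suc n\<close>. The profile of \<open>\<alpha> n\<close> thus stays constant while
  the score itself and the measure may vary.\<close>

lemma no_gap_sequence:
  assumes "\<epsilon> > 0" and no_gap: "\<not> (\<exists>h>0. surrogate_gap \<epsilon> h)"
  shows "\<exists>\<alpha>0 \<beta>0 \<mu> \<alpha>. \<forall>n. \<mu> n \<in> borel_probs \<and> L (\<alpha> n) = L \<alpha>0 \<and>
    \<epsilon> \<le> (LINT s|\<mu> n. L \<alpha>0 s - L \<beta>0 s) \<and>
    (\<forall>\<gamma>. cond_risk \<phi> (\<alpha> n) (\<mu> n) < cond_risk \<phi> \<gamma> (\<mu> n) + 1 / Suc n)"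
proof -
  obtain a b where ab: "a \<in> range L" "b \<in> range L" and
    none: "\<not> (\<exists>h>0. \<forall>\<mu>\<in>borel_probs. \<forall>\<alpha>. L \<alpha> = a \<and> \<epsilon> \<le> (LINT s|\<mu>. a s - b s) \<longrightarrow>
      (\<exists>\<gamma>. cond_risk \<phi> \<gamma> \<mu> + h \<le> cond_risk \<phi> \<alpha> \<mu>))"
    using ex_surrogate_gapI[OF \<open>\<epsilon> > 0\<close>] no_gap by blast
  from ab obtain \<alpha>0 \<beta>0 where eq: "a = L \<alpha>0" "b = L \<beta>0" by auto
  have "\<exists>\<mu> \<alpha>. \<mu> \<in> borel_probs \<and> L \<alpha> = a \<and> \<epsilon> \<le> (LINT s|\<mu>. a s - b s) \<and>
      (\<forall>\<gamma>. cond_risk \<phi> \<alpha> \<mu> < cond_risk \<phi> \<gamma> \<mu> + 1 / Suc n)" for n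
  proof -
    have "1 / real (Suc n) > 0" by simp
    with none show ?thesis by (meson not_le)
  qed
  then have "\<exists>\<mu> \<alpha>. \<forall>n. \<mu> n \<in> borel_probs \<and> L (\<alpha> n) = a \<and> \<epsilon> \<le> (LINT s|\<mu> n. a s - b s) \<and>
      (\<forall>\<gamma>. cond_risk \<phi> (\<alpha> n) (\<mu> n) < cond_risk \<phi> \<gamma> (\<mu> n) + 1 / Suc n)"
    by metis
  then show ?thesis unfolding eq by blast
qed

end

subsection \<open>Gaps on finite structure spaces\<close>

context surrogate_setting
begin

text \<open>The weights of the measures converge along a subsequence to those of some
  \<open>\<nu>\<close>. As \<open>\<phi>\<close> may be unbounded along \<open>\<alpha> n\<close>,
  its risks cannot simply be passed to the limit; instead the weights eventually dominate
  \<open>(1 - \<theta>) * v\<close>, and nonnegativity of \<open>\<phi>\<close> transfers the margin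
  at \<open>\<nu>\<close> up to that factor.\<close>

lemma finite_structures_gap:
  assumes fin: "finite (UNIV :: 's set)" and SC: "structure_consistent L \<phi>" and "\<epsilon> > 0"
  shows "\<exists>h>0. surrogate_gap \<epsilon> h"
proof (rule ccontr)
  assume "\<not> (\<exists>h>0. surrogate_gap \<epsilon> h)"
  from no_gap_sequence[OF \<open>\<epsilon> > 0\<close> this]
  obtain \<alpha>0 \<beta>0 \<mu> \<alpha> where seq: "\<forall>n. \<mu> n \<in> borel_probs \<and> L (\<alpha> n) = L \<alpha>0 \<and>
      \<epsilon> \<le> (LINT s|\<mu> n. L \<alpha>0 s - L \<beta>0 s) \<and>
      (\<forall>\<gamma>. cond_risk \<phi> (\<alpha> n) (\<mu> n) < cond_risk \<phi> \<gamma> (\<mu> n) + 1 / Suc n)"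
    by (elim exE)
  have \<mu>: "\<mu> n \<in> borel_probs" and \<alpha>: "L (\<alpha> n) = L \<alpha>0"
    and excess: "\<epsilon> \<le> (LINT s|\<mu> n. L \<alpha>0 s - L \<beta>0 s)"
    and near: "cond_risk \<phi> (\<alpha> n) (\<mu> n) < cond_risk \<phi> \<gamma> (\<mu> n) + 1 / Suc n" for n \<gamma>
    using seq by blast+
  have excess_cont: "continuous_on UNIV (\<lambda>s. L \<alpha>0 s - L \<beta>0 s)"
    by (intro continuous_intros L_cont)
  have "\<exists>w. (\<forall>s. 0 \<le> w s) \<and> sum w UNIV = 1 \<and> (\<forall>g :: 's \<Rightarrow> real. continuous_on UNIV g \<longrightarrow> (LINT s|\<mu> n. g s) = (\<Sum>s\<in>UNIV. w s * g s))" for n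
    by (rule finite_space_weights[OF fin \<mu>[of n]]) blast
  then obtain w where w: "\<And>n s. 0 \<le> w n s" "\<And>n. sum (w n) UNIV = 1"
      "\<And>n (g :: 's \<Rightarrow> real). continuous_on UNIV g \<Longrightarrow> (LINT s|\<mu> n. g s) = (\<Sum>s\<in>UNIV. w n s * g s)"
    by metis
  have "w n s \<le> 1" for n s
    using member_le_sum[of s UNIV "w n"] w fin by simp
  then have "\<bar>w n s\<bar> \<le> 1" for n s using w(1) by simp
  then obtain r v where r: "strict_mono (r :: nat \<Rightarrow> nat)" and v: "\<And>s. (\<lambda>n. w (r n) s) \<longlonglongrightarrow> v s"
    using convergent_subsequence_finite[OF fin] by (metis UNIV_I)
  have v_nonneg: "0 \<le> v s" for s
    using v w(1) by (intro LIMSEQ_le_const[OF v]) auto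
  have sums: "(\<lambda>n. \<Sum>s\<in>UNIV. w (r n) s * g s) \<longlonglongrightarrow> (\<Sum>s\<in>UNIV. v s * g s)" for g :: "'s \<Rightarrow> real"
    by (intro tendsto_intros v)
  have v_sum: "sum v UNIV = 1"
    using sums[of "\<lambda>_. 1"] w(2) by (simp add: LIMSEQ_const_iff)
  obtain \<nu> where \<nu>: "\<nu> \<in> borel_probs"
      "\<And>g :: 's \<Rightarrow> real. continuous_on UNIV g \<Longrightarrow> (LINT s|\<nu>. g s) = (\<Sum>s\<in>UNIV. v s * g s)"
    using finitely_supported_measure[OF fin, of v "\<lambda>s. s"] v_nonneg v_sum by blast
  obtain \<beta> h where h: "h > 0"
      "\<And>\<alpha> \<gamma>. cond_risk L \<gamma> \<nu> < cond_risk L \<alpha> \<nu> \<Longrightarrow> cond_risk \<phi> \<beta> \<nu> + h \<le> cond_risk \<phi> \<alpha> \<nu>"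
    using structure_consistent_gap[OF SC \<nu>(1)] by metis
  have "\<epsilon> \<le> (LINT s|\<nu>. L \<alpha>0 s - L \<beta>0 s)"
    unfolding \<nu>(2)[OF excess_cont]
    by (intro LIMSEQ_le_const[OF sums]) (use excess w(3)[OF excess_cont] in auto)
  \<comment> \<open>The excess inequality survives the limit, and the fixed profile makes every
    \<open>\<alpha> n\<close> a non-minimiser under the one measure \<open>\<nu>\<close>.\<close>
  then have "cond_risk L \<beta>0 \<nu> < cond_risk L (\<alpha> n) \<nu>" for n
    using \<open>\<epsilon> > 0\<close> integrable_cont[OF L_cont \<nu>(1)] by (simp add: cond_risk_def \<alpha>)
  from h(2)[OF this] have lower: "cond_risk \<phi> \<beta> \<nu> + h \<le> (\<Sum>s\<in>UNIV. v s * \<phi> (\<alpha> n) s)" for n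
    by (simp add: cond_risk_def \<nu>(2)[OF surr_cont])
  have le: "(1 - \<theta>) * (cond_risk \<phi> \<beta> \<nu> + h) \<le> cond_risk \<phi> \<beta> \<nu>" if \<theta>: "0 < \<theta>" "\<theta> < 1" for \<theta>
  proof -
    \<comment> \<open>Where \<open>v s\<close> vanishes, nonnegativity of the weights suffices;
      elsewhere \<open>(1 - \<theta>) * v s\<close> lies strictly below the limit.\<close>
    have "\<forall>\<^sub>F n in sequentially. (1 - \<theta>) * v s \<le> w (r n) s" for s
    proof (cases "v s = 0")
      case True then show ?thesis using w(1) by simp
    next
      case False
      then have "(1 - \<theta>) * v s < v s" using v_nonneg[of s] \<theta> by (simp add: less_le)
      from order_tendstoD(1)[OF v this] show ?thesis by eventually_elim simp
    qed
    then have "\<forall>\<^sub>F n in sequentially. \<forall>s\<in>UNIV. (1 - \<theta>) * v s \<le> w (r n) s"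
      using fin by (intro eventually_ball_finite) auto
    then have "\<forall>\<^sub>F n in sequentially. (1 - \<theta>) * (cond_risk \<phi> \<beta> \<nu> + h)
        \<le> (\<Sum>s\<in>UNIV. w (r n) s * \<phi> \<beta> s) + 1 / Suc (r n)"
    proof eventually_elim
      case (elim n)
      have "(1 - \<theta>) * (cond_risk \<phi> \<beta> \<nu> + h) \<le> (1 - \<theta>) * (\<Sum>s\<in>UNIV. v s * \<phi> (\<alpha> (r n)) s)"
        using lower \<theta> by (intro mult_left_mono) auto
      also have "\<dots> = (\<Sum>s\<in>UNIV. (1 - \<theta>) * v s * \<phi> (\<alpha> (r n)) s)"
        by (simp add: sum_distrib_left mult.assoc)
      also have "\<dots> \<le> (\<Sum>s\<in>UNIV. w (r n) s * \<phi> (\<alpha> (r n)) s)"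
        using elim surr_nonneg by (intro sum_mono mult_right_mono) auto
      also have "\<dots> \<le> (\<Sum>s\<in>UNIV. w (r n) s * \<phi> \<beta> s) + 1 / Suc (r n)"
        using near[of "r n" \<beta>] by (simp add: cond_risk_def w(3)[OF surr_cont])
      finally show ?case .
    qed
    moreover have "(\<lambda>n. (\<Sum>s\<in>UNIV. w (r n) s * \<phi> \<beta> s) + 1 / Suc (r n)) \<longlonglongrightarrow> (\<Sum>s\<in>UNIV. v s * \<phi> \<beta> s) + 0"
      using LIMSEQ_subseq_LIMSEQ[OF LIMSEQ_Suc[OF lim_1_over_n] r]
      by (intro tendsto_add sums) (simp add: o_def)
    ultimately have "(1 - \<theta>) * (cond_risk \<phi> \<beta> \<nu> + h) \<le> (\<Sum>s\<in>UNIV. v s * \<phi> \<beta> s) + 0"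
      by (intro tendsto_lowerbound) auto
    then show ?thesis by (simp add: cond_risk_def \<nu>(2)[OF surr_cont])
  qed
  define c where "c = cond_risk \<phi> \<beta> \<nu>"
  have c: "c \<ge> 0" unfolding c_def by (rule cond_risk_surr_nonneg)
  \<comment> \<open>With this choice \<open>(1 - \<theta>) * (c + h)\<close> equals
    \<open>c + h / 2\<close>, which exceeds \<open>c\<close>.\<close>
  define \<theta> where "\<theta> = h / (2 * (c + h))"
  have "0 < \<theta>" "\<theta> < 1" using c h(1) by (auto simp: \<theta>_def field_simps)
  from le[OF this] have "(1 - \<theta>) * (c + h) \<le> c" by (simp add: c_def)
  moreover have "\<theta> * (c + h) = h / 2" using c h(1) add_nonneg_pos[OF c h(1)] by (simp add: \<theta>_def del: distrib_left_numeral)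
  ultimately show False using h(1) by (simp add: algebra_simps)
qed

end

subsection \<open>Gaps for convex coercive surrogates\<close>

text \<open>Coercivity is required for each structure separately; point masses supply it from
  coercivity of the conditional surrogate risk.\<close>

locale convex_coercive_setting = surrogate_setting L \<phi>
  for L \<phi> :: "'a::euclidean_space \<Rightarrow> 's::topological_space \<Rightarrow> real" +
  assumes surr_convex: "convex_on UNIV (\<lambda>\<alpha>. \<phi> \<alpha> s)"
    and surr_coercive: "filterlim (\<lambda>\<alpha>. \<phi> \<alpha> s) at_top at_infinity"
begin

text \<open>The ball lies in a cube. By convexity the values on the cube are bounded by those at its
  finitely many vertices, and each vertex has a bound uniform over the compact structure
  space.\<close>

lemma surr_bounded_on_ball: "\<exists>B>0. \<forall>\<alpha> s. norm \<alpha> \<le> r \<longrightarrow> \<phi> \<alpha> s \<le> B"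
proof -
  define d where "d = \<bar>r\<bar> + 1"
  have "d > 0" by (simp add: d_def)
  then obtain V :: "'a set" where V: "finite V"
      "cbox (0 - (\<Sum>i\<in>Basis. d *\<^sub>R i)) (0 + (\<Sum>i\<in>Basis. d *\<^sub>R i)) = convex hull V"
    by (rule cube_convex_hull)
  have "\<exists>C. \<forall>s. \<phi> \<alpha> s \<le> C" for \<alpha>
  proof -
    have "bounded (range (\<phi> \<alpha>))"
      using compact_continuous_image[OF surr_cont compact_structures] compact_imp_bounded by blast
    then show ?thesis by (auto simp: bounded_iff intro: order_trans[OF abs_ge_self])
  qed
  then obtain C where C: "\<And>\<alpha> s. \<phi> \<alpha> s \<le> C \<alpha>" by metis
  define B where "B = (\<Sum>\<alpha>\<in>V. \<bar>C \<alpha>\<bar>) + 1"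
  have B: "\<phi> \<alpha> s \<le> B" if "\<alpha> \<in> V" for \<alpha> s
    using C[of \<alpha> s] member_le_sum[OF that, of "\<lambda>\<alpha>. \<bar>C \<alpha>\<bar>"] V(1) by (simp add: B_def)
  have "B > 0" by (simp add: B_def sum_nonneg add_nonneg_pos)
  moreover have "\<phi> \<alpha> s \<le> B" if "norm \<alpha> \<le> r" for \<alpha> s
  proof -
    have "\<bar>\<alpha> \<bullet> i\<bar> \<le> d" if "i \<in> Basis" for i
      using Basis_le_norm[OF that, of \<alpha>] \<open>norm \<alpha> \<le> r\<close> by (simp add: d_def)
    then have "\<alpha> \<in> convex hull V"
      unfolding V(2)[symmetric] by (auto simp: mem_box inner_sum_left_Basis abs_le_iff minus_le_iff)
    then show ?thesis
      using convex_on_convex_hull_bound[of V "\<lambda>\<alpha>. \<phi> \<alpha> s" B] B convex_on_subset[OF surr_convex] by blast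
  qed
  ultimately show ?thesis by blast
qed

text \<open>Prolonging the segment from \<open>\<alpha>\<close> through \<open>\<beta>\<close> by
  one unit stays in a ball where \<open>\<phi>\<close> is at most \<open>B\<close>; convexity then
  limits the slope, uniformly in \<open>s\<close>.\<close>

lemma surr_lipschitz_on_ball:
  "\<exists>B>0. \<forall>\<alpha> \<beta> s. norm \<alpha> \<le> r \<and> norm \<beta> \<le> r \<longrightarrow> \<phi> \<beta> s \<le> \<phi> \<alpha> s + B * norm (\<beta> - \<alpha>)"
proof -
  obtain B where B: "B > 0" "\<And>\<alpha> s. norm \<alpha> \<le> r + 1 \<Longrightarrow> \<phi> \<alpha> s \<le> B"
    using surr_bounded_on_ball by blast
  have "\<phi> \<beta> s \<le> \<phi> \<alpha> s + B * norm (\<beta> - \<alpha>)" if "norm \<alpha> \<le> r" "norm \<beta> \<le> r" for \<alpha> \<beta> s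
  proof (cases "\<alpha> = \<beta>")
    case False
    define d where "d = norm (\<beta> - \<alpha>)"
    have d: "d > 0" using False by (simp add: d_def)
    define z where "z = \<beta> + (1 / d) *\<^sub>R (\<beta> - \<alpha>)"
    have "norm z \<le> norm \<beta> + norm ((1 / d) *\<^sub>R (\<beta> - \<alpha>))" unfolding z_def by (rule norm_triangle_ineq)
    also have "\<dots> \<le> r + 1" using that d by (simp add: d_def)
    finally have z: "\<phi> z s \<le> B" by (rule B(2))
    \<comment> \<open>\<open>z\<close> is at distance \<open>1 + d\<close> from
      \<open>\<alpha>\<close>, so this is the weight that places \<open>\<beta>\<close> between
      \<open>\<alpha>\<close> and \<open>z\<close>.\<close>
    define t where "t = d / (1 + d)"
    have t: "0 \<le> t" "t \<le> 1" "t \<le> d" using d by (auto simp: t_def field_simps)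
    have "1 + d \<noteq> 0" using d by simp
    then have "t + t / d = 1" using d by (simp add: t_def add_divide_distrib[symmetric])
    then have "t / d = 1 - t" by simp
    then have "t *\<^sub>R z = t *\<^sub>R \<beta> + (1 - t) *\<^sub>R (\<beta> - \<alpha>)"
      by (simp add: z_def scaleR_add_right)
    then have "(1 - t) *\<^sub>R \<alpha> + t *\<^sub>R z = \<beta>" by (simp add: algebra_simps)
    then have "\<phi> \<beta> s \<le> (1 - t) * \<phi> \<alpha> s + t * \<phi> z s"
      using convex_onD[OF surr_convex t(1,2), of \<alpha> z s] by simp
    also have "\<dots> \<le> 1 * \<phi> \<alpha> s + d * B"
      using t z B(1) surr_nonneg by (intro add_mono mult_mono) auto
    finally show ?thesis by (simp add: d_def mult.commute)
  qed simp
  with B(1) show ?thesis by blast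
qed

text \<open>Continuity in \<open>s\<close> at a fixed score combines with the Lipschitz bound in the
  score, whose constant is independent of \<open>s\<close>.\<close>

lemma surr_jointly_continuous: "continuous_on UNIV (\<lambda>(\<alpha>, s). \<phi> \<alpha> s)"
  unfolding continuous_on_def
proof (intro ballI)
  fix x :: "'a \<times> 's"
  obtain \<alpha> s where x: "x = (\<alpha>, s)" by fastforce
  obtain B where B: "\<And>\<beta> \<gamma> s. norm \<beta> \<le> norm \<alpha> + 1 \<and> norm \<gamma> \<le> norm \<alpha> + 1 \<Longrightarrow> \<phi> \<gamma> s \<le> \<phi> \<beta> s + B * norm (\<gamma> - \<beta>)"
    using surr_lipschitz_on_ball by blast
  have fst: "((\<lambda>y. fst y) \<longlongrightarrow> \<alpha>) (at x)" and snd: "((\<lambda>y. snd y) \<longlongrightarrow> s) (at x)"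
    using tendsto_fst[OF tendsto_ident_at[of x UNIV]] tendsto_snd[OF tendsto_ident_at[of x UNIV]] by (auto simp: x)
  have "((\<lambda>y. \<phi> \<alpha> (snd y)) \<longlongrightarrow> \<phi> \<alpha> s) (at x)"
    by (rule continuous_on_tendsto_compose[OF surr_cont snd]) auto
  then have "((\<lambda>y. \<phi> \<alpha> (snd y) - \<phi> \<alpha> s) \<longlongrightarrow> \<phi> \<alpha> s - \<phi> \<alpha> s) (at x)"
    by (intro tendsto_intros)
  moreover have "((\<lambda>y. B * norm (fst y - \<alpha>)) \<longlongrightarrow> B * norm (\<alpha> - \<alpha>)) (at x)"
    by (intro tendsto_intros fst)
  ultimately have lim: "((\<lambda>y. B * norm (fst y - \<alpha>) + \<bar>\<phi> \<alpha> (snd y) - \<phi> \<alpha> s\<bar>) \<longlongrightarrow> 0) (at x)"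
    by (intro tendsto_add_zero tendsto_rabs_zero) auto
  have "\<forall>\<^sub>F y in at x. dist (fst y) \<alpha> < 1"
    using fst by (rule tendstoD) simp
  then have "\<forall>\<^sub>F y in at x. norm (\<phi> (fst y) (snd y) - \<phi> \<alpha> s) \<le> B * norm (fst y - \<alpha>) + \<bar>\<phi> \<alpha> (snd y) - \<phi> \<alpha> s\<bar>"
  proof eventually_elim
    case (elim y)
    then have n: "norm (fst y) \<le> norm \<alpha> + 1"
      using norm_triangle_sub[of "fst y" \<alpha>] by (simp add: dist_norm)
    have "\<phi> (fst y) (snd y) \<le> \<phi> \<alpha> (snd y) + B * norm (fst y - \<alpha>)" using B n by simp
    moreover have "\<phi> \<alpha> (snd y) \<le> \<phi> (fst y) (snd y) + B * norm (fst y - \<alpha>)"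
      using B[of "fst y" \<alpha>] n by (simp add: norm_minus_commute)
    ultimately show ?case by simp
  qed
  from LIM_zero_cancel[OF Lim_null_comparison[OF this lim]]
  have "((\<lambda>y. \<phi> (fst y) (snd y)) \<longlongrightarrow> \<phi> \<alpha> s) (at x)" .
  then show "((\<lambda>(\<alpha>, s). \<phi> \<alpha> s) \<longlongrightarrow> (case x of (\<alpha>, s) \<Rightarrow> \<phi> \<alpha> s)) (at x within UNIV)"
    by (simp add: x case_prod_unfold)
qed

text \<open>Difference quotients of a convex function grow along a ray: the nearer point is a convex
  combination of \<open>\<alpha>\<close> and the farther one.\<close>

lemma surr_ray:
  assumes "0 < t" "t \<le> t'"
  shows "(\<phi> (\<alpha> + t *\<^sub>R v) s - \<phi> \<alpha> s) / t \<le> (\<phi> (\<alpha> + t' *\<^sub>R v) s - \<phi> \<alpha> s) / t'"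
proof -
  have t': "t' > 0" using assms by simp
  have "\<alpha> + t *\<^sub>R v = (1 - t / t') *\<^sub>R \<alpha> + (t / t') *\<^sub>R (\<alpha> + t' *\<^sub>R v)"
    using t' by (simp add: algebra_simps)
  then have "\<phi> (\<alpha> + t *\<^sub>R v) s \<le> (1 - t / t') * \<phi> \<alpha> s + t / t' * \<phi> (\<alpha> + t' *\<^sub>R v) s"
    using convex_onD[OF surr_convex, of "t / t'" \<alpha> "\<alpha> + t' *\<^sub>R v" s] assms t' by simp
  then show ?thesis using assms t' by (simp add: field_simps)
qed

text \<open>In each direction and for each structure a rise above 1 occurs at some radius.
  Compactness of sphere times structures leaves finitely many radii, and growing difference
  quotients carry the rise outwards.\<close>

lemma uniformly_coercive: "\<exists>r. \<forall>\<alpha> s. r \<le> norm \<alpha> \<longrightarrow> \<phi> 0 s + 1 \<le> \<phi> \<alpha> s"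
proof -
  define W where "W n = {x. \<phi> 0 (snd x) + 1 < \<phi> (real (Suc n) *\<^sub>R fst x) (snd x)}" for n :: nat
  have W_open: "open (W n)" for n
  proof -
    have "continuous_on UNIV (\<lambda>x :: 'a \<times> 's. case (real (Suc n) *\<^sub>R fst x, snd x) of (\<alpha>, s) \<Rightarrow> \<phi> \<alpha> s)"
      by (rule continuous_on_compose2[OF surr_jointly_continuous]) (auto intro!: continuous_intros)
    moreover have "continuous_on UNIV (\<lambda>x :: 'a \<times> 's. \<phi> 0 (snd x) + 1)"
      by (intro continuous_intros continuous_on_compose2[OF surr_cont]) auto
    ultimately show ?thesis unfolding W_def by (intro open_Collect_less) simp_all
  qed
  have cover: "sphere 0 1 \<times> (UNIV :: 's set) \<subseteq> (\<Union>n\<in>UNIV. W n)"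
  proof
    fix x :: "'a \<times> 's" assume "x \<in> sphere 0 1 \<times> UNIV"
    then have x: "norm (fst x) = 1" by auto
    have "\<forall>\<^sub>F \<alpha> in at_infinity. \<phi> 0 (snd x) + 1 < \<phi> \<alpha> (snd x)"
      using surr_coercive[of "snd x"] by (simp add: filterlim_at_top_dense)
    then obtain r where r: "\<And>\<alpha>. r \<le> norm \<alpha> \<Longrightarrow> \<phi> 0 (snd x) + 1 < \<phi> \<alpha> (snd x)"
      by (auto simp: eventually_at_infinity)
    obtain n :: nat where "r \<le> real n" using real_arch_simple by blast
    then show "x \<in> (\<Union>n\<in>UNIV. W n)"
      using r[of "real (Suc n) *\<^sub>R fst x"] x by (auto simp: W_def)
  qed
  obtain N where N: "finite N" "sphere 0 1 \<times> (UNIV :: 's set) \<subseteq> (\<Union>n\<in>N. W n)"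
    using compactE_image[OF compact_Times[OF compact_sphere compact_structures] W_open cover] by auto
  \<comment> \<open>The sum dominates every selected radius, and the extra 1 keeps \<open>m\<close>
    positive.\<close>
  define m where "m = (\<Sum>n\<in>N. Suc n) + 1"
  have "\<phi> 0 s + 1 \<le> \<phi> \<alpha> s" if \<alpha>: "real m \<le> norm \<alpha>" for \<alpha> s
  proof -
    have pos: "norm \<alpha> > 0" using \<alpha> by (rule less_le_trans[rotated]) (simp add: m_def add_pos_nonneg sum_nonneg)
    then have "((1 / norm \<alpha>) *\<^sub>R \<alpha>, s) \<in> sphere 0 1 \<times> UNIV" by simp
    then obtain n where n: "n \<in> N" "((1 / norm \<alpha>) *\<^sub>R \<alpha>, s) \<in> W n" using N(2) by blast
    have "Suc n \<le> m" using member_le_sum[OF n(1), of Suc] N(1) by (simp add: m_def)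
    then have le: "real (Suc n) \<le> norm \<alpha>" using \<alpha> by linarith
    \<comment> \<open>The slope at radius \<open>Suc n\<close> is at least \<open>1 / Suc n\<close>,
      so at the larger radius \<open>norm \<alpha>\<close> the rise is at least
      \<open>norm \<alpha> / Suc n\<close>.\<close>
    have "1 / real (Suc n) \<le> (\<phi> (0 + real (Suc n) *\<^sub>R ((1 / norm \<alpha>) *\<^sub>R \<alpha>)) s - \<phi> 0 s) / real (Suc n)"
      using n(2) by (intro divide_right_mono) (auto simp: W_def)
    also have "\<dots> \<le> (\<phi> (0 + norm \<alpha> *\<^sub>R ((1 / norm \<alpha>) *\<^sub>R \<alpha>)) s - \<phi> 0 s) / norm \<alpha>"
      by (rule surr_ray) (use le in auto)
    also have "\<dots> = (\<phi> \<alpha> s - \<phi> 0 s) / norm \<alpha>" using pos by simp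
    finally have "norm \<alpha> / real (Suc n) \<le> \<phi> \<alpha> s - \<phi> 0 s" using pos by (simp add: field_simps)
    moreover have "1 \<le> norm \<alpha> / real (Suc n)" using le by (simp add: field_simps)
    ultimately show ?thesis by linarith
  qed
  then show ?thesis by blast
qed

lemma cond_risk_surr_lipschitz:
  "\<exists>B>0. \<forall>\<alpha> \<beta>. \<forall>\<mu>\<in>borel_probs. norm \<alpha> \<le> r \<and> norm \<beta> \<le> r \<longrightarrow>
    cond_risk \<phi> \<beta> \<mu> \<le> cond_risk \<phi> \<alpha> \<mu> + B * norm (\<beta> - \<alpha>)"
proof -
  obtain B where B: "B > 0" "\<And>\<alpha> \<beta> s. norm \<alpha> \<le> r \<and> norm \<beta> \<le> r \<Longrightarrow> \<phi> \<beta> s \<le> \<phi> \<alpha> s + B * norm (\<beta> - \<alpha>)"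
    using surr_lipschitz_on_ball by blast
  have "cond_risk \<phi> \<beta> \<mu> \<le> cond_risk \<phi> \<alpha> \<mu> + B * norm (\<beta> - \<alpha>)"
    if \<mu>: "\<mu> \<in> borel_probs" and n: "norm \<alpha> \<le> r" "norm \<beta> \<le> r" for \<alpha> \<beta> \<mu>
  proof -
    interpret prob_space \<mu> using \<mu> by (simp add: borel_probs_def)
    have "(LINT s|\<mu>. \<phi> \<beta> s) \<le> (LINT s|\<mu>. \<phi> \<alpha> s + B * norm (\<beta> - \<alpha>))"
      using integrable_cont[OF surr_cont \<mu>] B(2) n by (intro integral_mono) auto
    then show ?thesis
      using integrable_cont[OF surr_cont \<mu>] by (simp add: cond_risk_def prob_space)
  qed
  with B(1) show ?thesis by blast
qed

text \<open>The pairs \<open>(g, k s)\<close>, with \<open>g\<close> a subgradient of \<open>\<phi>(\<cdot>, s)\<close> at \<open>\<alpha>\<close>, form a compact set. Either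
  its convex hull contains some \<open>(0, y)\<close> with \<open>y \<ge> \<epsilon>\<close>, which yields a finitely supported measure
  minimised at \<open>\<alpha>\<close>, or a separating hyperplane yields a direction in which the surrogate risk
  decreases at a uniform rate. This replaces passing to a weak limit of measures, for which a
  Borel measure need not be available on a non-Hausdorff space.\<close>

lemma ex_minimised_measure:
  fixes k :: "'s \<Rightarrow> real"
  assumes k: "continuous_on UNIV k"
    and no_descent: "\<And>v t \<kappa>. t > 0 \<Longrightarrow> \<kappa> > 0 \<Longrightarrow> \<exists>\<mu>\<in>borel_probs.
      \<epsilon> \<le> (LINT s|\<mu>. k s) \<and> cond_risk \<phi> \<alpha> \<mu> < cond_risk \<phi> (\<alpha> + t *\<^sub>R v) \<mu> + \<kappa>"
  obtains \<nu> where "\<nu> \<in> borel_probs" "\<epsilon> \<le> (LINT s|\<nu>. k s)" "\<And>\<gamma>. cond_risk \<phi> \<alpha> \<nu> \<le> cond_risk \<phi> \<gamma> \<nu>"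
proof -
  obtain M where M: "M > 0" "\<And>\<beta> s. norm \<beta> \<le> norm \<alpha> + 1 \<Longrightarrow> \<phi> \<beta> s \<le> M"
    using surr_bounded_on_ball by blast
  \<comment> \<open>Cutting with \<open>cball 0 M\<close> gives compactness and loses no
    subgradient, as \<open>subgradient_in_X\<close> shows.\<close>
  define X where "X = (cball 0 M \<times> (UNIV :: 's set)) \<inter>
    (\<Inter>\<beta>. {x. \<phi> \<alpha> (snd x) + fst x \<bullet> (\<beta> - \<alpha>) \<le> \<phi> \<beta> (snd x)})"
  define D where "D = (\<lambda>x. (fst x, k (snd x))) ` X"
  have snd_cont: "continuous_on UNIV (\<lambda>x :: 'a \<times> 's. f (snd x))" if "continuous_on UNIV f" for f :: "'s \<Rightarrow> real"
    by (rule continuous_on_compose2[OF that]) (auto intro!: continuous_intros)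
  have "closed (\<Inter>\<beta>. {x. \<phi> \<alpha> (snd x) + fst x \<bullet> (\<beta> - \<alpha>) \<le> \<phi> \<beta> (snd x)})"
    by (intro closed_INT ballI closed_Collect_le continuous_intros snd_cont surr_cont)
  then have "compact X"
    unfolding X_def by (intro compact_Int_closed compact_Times compact_cball compact_structures)
  moreover have "continuous_on UNIV (\<lambda>x :: 'a \<times> 's. (fst x, k (snd x)))"
    by (intro continuous_on_Pair continuous_on_fst continuous_on_id snd_cont k)
  ultimately have D_compact: "compact D"
    unfolding D_def using compact_continuous_image continuous_on_subset by blast
  have subgradient_in_X: "(g, s) \<in> X" if g: "\<forall>\<beta>. \<phi> \<alpha> s + g \<bullet> (\<beta> - \<alpha>) \<le> \<phi> \<beta> s" for g s
  proof -
    have "norm g \<le> M"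
    proof (cases "g = 0")
      case False
      \<comment> \<open>A unit step along \<open>g\<close> raises \<open>\<phi>\<close> by at least
        \<open>norm g\<close>, yet its value there is at most \<open>M\<close>.\<close>
      define \<beta> where "\<beta> = \<alpha> + (1 / norm g) *\<^sub>R g"
      have "norm \<beta> \<le> norm \<alpha> + norm ((1 / norm g) *\<^sub>R g)" unfolding \<beta>_def by (rule norm_triangle_ineq)
      then have "\<phi> \<beta> s \<le> M" using False by (intro M(2)) simp
      moreover have "g \<bullet> (\<beta> - \<alpha>) = norm g" by (simp add: \<beta>_def dot_square_norm power2_eq_square)
      ultimately show ?thesis using g[rule_format, of \<beta>] surr_nonneg[of \<alpha> s] by simp
    qed (use M in simp)
    with g show ?thesis by (simp add: X_def)
  qed
  obtain s0 :: 's where True by blast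
  obtain g0 where "\<forall>\<beta>. \<phi> \<alpha> s0 + g0 \<bullet> (\<beta> - \<alpha>) \<le> \<phi> \<beta> s0"
    by (rule ex_subgradient[OF surr_convex, of \<alpha> s0 0 0]) auto
  then have "(g0, s0) \<in> X" by (rule subgradient_in_X)
  then have D_ne: "convex hull D \<noteq> {}" by (auto simp: D_def)
  define H where "H = {0 :: 'a} \<times> {\<epsilon>..}"
  have H: "convex H" "closed H" by (auto simp: H_def intro: convex_Times closed_Times)
  show ?thesis
  proof (cases "convex hull D \<inter> H = {}")
    \<comment> \<open>The convex weights of \<open>(0, y)\<close> become the weights of the measure.
      The averaged subgradient is zero, so \<open>\<alpha>\<close> is a minimiser, and the averaged
      \<open>k\<close> is \<open>y\<close>.\<close>
    case False
    then obtain y where y: "y \<ge> \<epsilon>" "(0, y) \<in> convex hull D" by (auto simp: H_def)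
    then obtain T u where T: "finite T" "T \<subseteq> D" "\<And>z. z \<in> T \<Longrightarrow> 0 \<le> u z" "sum u T = 1"
        "(\<Sum>z\<in>T. u z *\<^sub>R z) = (0, y)"
      unfolding convex_hull_explicit by auto
    have "\<forall>z. \<exists>s. z \<in> T \<longrightarrow> (fst z, s) \<in> X \<and> k s = snd z"
      using T(2) by (fastforce simp: D_def)
    then obtain \<sigma> where \<sigma>: "\<And>z. z \<in> T \<Longrightarrow> (fst z, \<sigma> z) \<in> X \<and> k (\<sigma> z) = snd z" by metis
    obtain \<nu> where \<nu>: "\<nu> \<in> borel_probs"
        "\<And>g :: 's \<Rightarrow> real. continuous_on UNIV g \<Longrightarrow> (LINT s|\<nu>. g s) = (\<Sum>z\<in>T. u z * g (\<sigma> z))"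
      using finitely_supported_measure[OF T(1), of u \<sigma>] T(3,4) by blast
    have y_sum: "(\<Sum>z\<in>T. u z * snd z) = y" and g_sum: "(\<Sum>z\<in>T. u z *\<^sub>R fst z) = 0"
      using arg_cong[OF T(5), of snd] arg_cong[OF T(5), of fst] by (simp_all add: snd_sum fst_sum)
    show ?thesis
    proof
      show "\<nu> \<in> borel_probs" by fact
      show "\<epsilon> \<le> (LINT s|\<nu>. k s)" using y(1) y_sum \<sigma> by (simp add: \<nu>(2)[OF k])
      fix \<gamma>
      have "cond_risk \<phi> \<alpha> \<nu> = (\<Sum>z\<in>T. u z * \<phi> \<alpha> (\<sigma> z)) + (\<Sum>z\<in>T. u z *\<^sub>R fst z) \<bullet> (\<gamma> - \<alpha>)"
        by (simp add: cond_risk_def \<nu>(2)[OF surr_cont] g_sum)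
      also have "\<dots> = (\<Sum>z\<in>T. u z * (\<phi> \<alpha> (\<sigma> z) + fst z \<bullet> (\<gamma> - \<alpha>)))"
        by (simp add: inner_sum_left sum.distrib distrib_left)
      also have "\<dots> \<le> (\<Sum>z\<in>T. u z * \<phi> \<gamma> (\<sigma> z))"
        using \<sigma> T(3) by (intro sum_mono mult_left_mono) (auto simp: X_def)
      also have "\<dots> = cond_risk \<phi> \<gamma> \<nu>" by (simp add: cond_risk_def \<nu>(2)[OF surr_cont])
      finally show "cond_risk \<phi> \<alpha> \<nu> \<le> cond_risk \<phi> \<gamma> \<nu>" .
    qed
  next
    case True
    then obtain a b where ab: "\<forall>x\<in>convex hull D. a \<bullet> x < b" "\<forall>x\<in>H. b < a \<bullet> x"
      using separating_hyperplane_compact_closed[OF convex_convex_hull compact_convex_hull[OF D_compact] D_ne H]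
      by blast
    obtain v c where a: "a = (v, c)" by fastforce
    have sep_D: "v \<bullet> g + c * k s < b" if "(g, s) \<in> X" for g s
    proof -
      have "(g, k s) \<in> convex hull D" using that by (intro hull_inc) (force simp: D_def)
      with ab(1) show ?thesis by (auto simp: a)
    qed
    have sep_H: "b < c * y" if "y \<ge> \<epsilon>" for y
      using ab(2) that by (auto simp: a H_def)
    \<comment> \<open>\<open>c * y\<close> stays above \<open>b\<close> for arbitrarily large
      \<open>y\<close>, which rules out a negative \<open>c\<close>.\<close>
    have c: "c \<ge> 0"
    proof (rule ccontr)
      assume "\<not> c \<ge> 0"
      then have "c * max \<epsilon> (b / c) \<le> c * (b / c)" by (intro mult_left_mono_neg) auto
      then show False using sep_H[of "max \<epsilon> (b / c)"] \<open>\<not> c \<ge> 0\<close> by simp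
    qed
    \<comment> \<open>Structures for which a step \<open>1 / Suc n\<close> along \<open>v\<close>
      already has slope below \<open>b - c * k s\<close>. These sets are open and increase with
      \<open>n\<close>, so compactness selects one step for all structures.\<close>
    define U where "U n = {s. (\<phi> (\<alpha> + (1 / Suc n) *\<^sub>R v) s - \<phi> \<alpha> s) / (1 / Suc n) < b - c * k s}" for n
    have U_open: "open (U n)" for n
      unfolding U_def by (intro open_Collect_less continuous_intros surr_cont k) simp
    have U_mono: "U n \<subseteq> U m" if "n \<le> m" for n m
    proof
      fix s assume "s \<in> U n"
      moreover have "1 / real (Suc m) \<le> 1 / real (Suc n)" using that by (intro frac_le) auto
      from surr_ray[OF _ this, of \<alpha> v s]
      have "(\<phi> (\<alpha> + (1 / Suc m) *\<^sub>R v) s - \<phi> \<alpha> s) / (1 / Suc m)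
          \<le> (\<phi> (\<alpha> + (1 / Suc n) *\<^sub>R v) s - \<phi> \<alpha> s) / (1 / Suc n)" by simp
      ultimately show "s \<in> U m" unfolding U_def mem_Collect_eq by (rule le_less_trans[rotated])
    qed
    have cover: "UNIV \<subseteq> (\<Union>n\<in>UNIV. U n)"
    proof
      fix s show "s \<in> (\<Union>n\<in>UNIV. U n)"
      proof (rule ccontr)
        assume "s \<notin> (\<Union>n\<in>UNIV. U n)"
        then have "s \<notin> U n" for n by blast
        then have not_U: "b - c * k s \<le> (\<phi> (\<alpha> + (1 / Suc n) *\<^sub>R v) s - \<phi> \<alpha> s) / (1 / Suc n)" for n
          unfolding U_def mem_Collect_eq not_less .
        \<comment> \<open>Outside all \<open>U n\<close> the slope bound holds for every step, so
          some subgradient has slope at least \<open>b - c * k s\<close> along \<open>v\<close>,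
          against the separation.\<close>
        have "\<phi> \<alpha> s + t * (b - c * k s) \<le> \<phi> (\<alpha> + t *\<^sub>R v) s" if "t \<ge> 0" for t
        proof (cases "t = 0")
          case False
          with that have t: "t > 0" by simp
          then obtain n where n: "1 / real (Suc n) < t" using nat_approx_posE by blast
          have "b - c * k s \<le> (\<phi> (\<alpha> + t *\<^sub>R v) s - \<phi> \<alpha> s) / t"
            by (rule order_trans[OF not_U[of n] surr_ray]) (use n in auto)
          then have "(b - c * k s) * t \<le> \<phi> (\<alpha> + t *\<^sub>R v) s - \<phi> \<alpha> s"
            using pos_le_divide_eq[OF t] by blast
          then show ?thesis by (subst mult.commute) linarith
        qed simp
        then obtain g where g: "\<forall>\<beta>. \<phi> \<alpha> s + g \<bullet> (\<beta> - \<alpha>) \<le> \<phi> \<beta> s" "b - c * k s \<le> g \<bullet> v"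
          by (rule ex_subgradient[OF surr_convex])
        from sep_D[OF subgradient_in_X[OF g(1)]] g(2) show False
          using inner_commute[of g v] by linarith
      qed
    qed
    obtain N where N: "finite N" "UNIV \<subseteq> (\<Union>n\<in>N. U n)"
      using compactE_image[OF compact_structures U_open cover] by auto
    obtain m where m: "\<And>n. n \<in> N \<Longrightarrow> n \<le> m" using N(1) finite_nat_set_iff_bounded_le by auto
    define t where "t = 1 / real (Suc m)"
    have t: "t > 0" by (simp add: t_def)
    have U: "s \<in> U m" for s using N(2) U_mono[OF m] by blast
    have descent: "\<phi> (\<alpha> + t *\<^sub>R v) s \<le> \<phi> \<alpha> s + t * (b - c * k s)" for s
    proof -
      have "(\<phi> (\<alpha> + t *\<^sub>R v) s - \<phi> \<alpha> s) / t < b - c * k s"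
        using U[of s] unfolding U_def t_def by blast
      then have "\<phi> (\<alpha> + t *\<^sub>R v) s - \<phi> \<alpha> s < (b - c * k s) * t"
        using pos_divide_less_eq[OF t] by blast
      then show ?thesis by (subst mult.commute) linarith
    qed
    \<comment> \<open>The decrease guaranteed after integration when \<open>k\<close> averages at
      least \<open>\<epsilon>\<close>; it is positive because \<open>(0, \<epsilon>)\<close> lies in
      \<open>H\<close>.\<close>
    define \<kappa> where "\<kappa> = t * (c * \<epsilon> - b)"
    have "\<kappa> > 0" using t sep_H[of \<epsilon>] by (simp add: \<kappa>_def)
    then obtain \<mu> where \<mu>: "\<mu> \<in> borel_probs" "\<epsilon> \<le> (LINT s|\<mu>. k s)"
        "cond_risk \<phi> \<alpha> \<mu> < cond_risk \<phi> (\<alpha> + t *\<^sub>R v) \<mu> + \<kappa>"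
      using no_descent[OF t] by blast
    interpret prob_space \<mu> using \<mu>(1) by (simp add: borel_probs_def)
    note int = integrable_cont[OF surr_cont \<mu>(1)] integrable_cont[OF k \<mu>(1)]
    have "cond_risk \<phi> (\<alpha> + t *\<^sub>R v) \<mu> \<le> (LINT s|\<mu>. \<phi> \<alpha> s + t * (b - c * k s))"
      unfolding cond_risk_def by (intro integral_mono descent) (use int in auto)
    also have "\<dots> = cond_risk \<phi> \<alpha> \<mu> + t * (b - c * (LINT s|\<mu>. k s))"
      using int by (simp add: cond_risk_def prob_space)
    also have "\<dots> \<le> cond_risk \<phi> \<alpha> \<mu> + t * (b - c * \<epsilon>)"
      using t c \<mu>(2) by (intro add_left_mono mult_left_mono diff_left_mono) auto
    also have "\<dots> = cond_risk \<phi> \<alpha> \<mu> - \<kappa>" by (simp add: \<kappa>_def algebra_simps)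
    finally show ?thesis using \<mu>(3) by simp
  qed
qed

text \<open>Uniform coercivity confines \<open>\<alpha> n\<close> to a ball, so a subsequence tends
  to some \<open>\<alpha>'\<close>. A single measure minimised at \<open>\<alpha>'\<close> replaces
  a limit of the measures and contradicts the margin from structure consistency.\<close>

lemma convex_gap:
  assumes SC: "structure_consistent L \<phi>" and "\<epsilon> > 0"
  shows "\<exists>h>0. surrogate_gap \<epsilon> h"
proof (rule ccontr)
  assume "\<not> (\<exists>h>0. surrogate_gap \<epsilon> h)"
  from no_gap_sequence[OF \<open>\<epsilon> > 0\<close> this]
  obtain \<alpha>0 \<beta>0 \<mu> \<alpha> where seq: "\<forall>n. \<mu> n \<in> borel_probs \<and> L (\<alpha> n) = L \<alpha>0 \<and>
      \<epsilon> \<le> (LINT s|\<mu> n. L \<alpha>0 s - L \<beta>0 s) \<and>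
      (\<forall>\<gamma>. cond_risk \<phi> (\<alpha> n) (\<mu> n) < cond_risk \<phi> \<gamma> (\<mu> n) + 1 / Suc n)"
    by (elim exE)
  have \<mu>: "\<mu> n \<in> borel_probs" and \<alpha>: "L (\<alpha> n) = L \<alpha>0"
    and excess: "\<epsilon> \<le> (LINT s|\<mu> n. L \<alpha>0 s - L \<beta>0 s)"
    and near: "cond_risk \<phi> (\<alpha> n) (\<mu> n) < cond_risk \<phi> \<gamma> (\<mu> n) + 1 / Suc n" for n \<gamma>
    using seq by blast+
  have excess_cont: "continuous_on UNIV (\<lambda>s. L \<alpha>0 s - L \<beta>0 s)"
    by (intro continuous_intros L_cont)
  obtain r where r: "\<And>\<alpha> s. r \<le> norm \<alpha> \<Longrightarrow> \<phi> 0 s + 1 \<le> \<phi> \<alpha> s" using uniformly_coercive by blast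
  have \<alpha>_r: "norm (\<alpha> n) \<le> r" for n
  proof (rule ccontr)
    assume "\<not> norm (\<alpha> n) \<le> r"
    interpret prob_space "\<mu> n" using \<mu> by (simp add: borel_probs_def)
    note int = integrable_cont[OF surr_cont \<mu>]
    have "(LINT s|\<mu> n. \<phi> 0 s + 1) \<le> cond_risk \<phi> (\<alpha> n) (\<mu> n)"
      unfolding cond_risk_def using r \<open>\<not> norm (\<alpha> n) \<le> r\<close> int by (intro integral_mono) auto
    then have "cond_risk \<phi> 0 (\<mu> n) + 1 \<le> cond_risk \<phi> (\<alpha> n) (\<mu> n)"
      using int by (simp add: cond_risk_def prob_space)
    \<comment> \<open>Competing against score 0, near-optimality allows an excess below
      \<open>1 / Suc n\<close>, hence below the forced rise of 1.\<close>
    also note near[of n 0]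
    finally show False by simp
  qed
  have "bounded (range \<alpha>)" using \<alpha>_r by (auto simp: bounded_iff)
  then obtain \<alpha>' \<rho> where \<rho>: "strict_mono (\<rho> :: nat \<Rightarrow> nat)" "(\<lambda>n. \<alpha> (\<rho> n)) \<longlonglongrightarrow> \<alpha>'"
    using bounded_imp_convergent_subsequence[of \<alpha>] by (auto simp: o_def)
  have \<alpha>'_r: "norm \<alpha>' \<le> r" using tendsto_norm[OF \<rho>(2)] \<alpha>_r by (intro LIMSEQ_le_const2) auto
  obtain B where B: "\<And>\<alpha> \<beta> \<mu>. \<mu> \<in> borel_probs \<Longrightarrow> norm \<alpha> \<le> r \<Longrightarrow> norm \<beta> \<le> r \<Longrightarrow>
      cond_risk \<phi> \<beta> \<mu> \<le> cond_risk \<phi> \<alpha> \<mu> + B * norm (\<beta> - \<alpha>)"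
    using cond_risk_surr_lipschitz by blast
  have "(\<lambda>n. B * norm (\<alpha> (\<rho> n) - \<alpha>')) \<longlonglongrightarrow> B * norm (\<alpha>' - \<alpha>')"
    by (intro tendsto_intros \<rho>(2))
  then have B_lim: "(\<lambda>n. B * norm (\<alpha> (\<rho> n) - \<alpha>')) \<longlonglongrightarrow> 0" by simp
  have "(\<lambda>n. 1 / real (Suc (\<rho> n)) + B * norm (\<alpha> (\<rho> n) - \<alpha>')) \<longlonglongrightarrow> 0 + 0"
    using LIMSEQ_subseq_LIMSEQ[OF LIMSEQ_Suc[OF lim_1_over_n] \<rho>(1)]
    by (intro tendsto_add B_lim) (simp add: o_def)
  then have slack: "(\<lambda>n. 1 / real (Suc (\<rho> n)) + B * norm (\<alpha> (\<rho> n) - \<alpha>')) \<longlonglongrightarrow> 0" by simp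
  \<comment> \<open>Replacing \<open>\<alpha> (\<rho> n)\<close> by \<open>\<alpha>'\<close> costs a
    Lipschitz term; together with the slack \<open>1 / Suc (\<rho> n)\<close> it eventually falls
    below \<open>\<kappa>\<close>.\<close>
  have no_descent: "\<exists>\<mu>\<in>borel_probs. \<epsilon> \<le> (LINT s|\<mu>. L \<alpha>0 s - L \<beta>0 s) \<and>
      cond_risk \<phi> \<alpha>' \<mu> < cond_risk \<phi> (\<alpha>' + t *\<^sub>R v) \<mu> + \<kappa>" if "t > 0" "\<kappa> > 0" for v t \<kappa>
  proof -
    have "\<forall>\<^sub>F n in sequentially. 1 / real (Suc (\<rho> n)) + B * norm (\<alpha> (\<rho> n) - \<alpha>') < \<kappa>"
      using order_tendstoD(2)[OF slack \<open>\<kappa> > 0\<close>] .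
    then obtain n where n: "1 / real (Suc (\<rho> n)) + B * norm (\<alpha> (\<rho> n) - \<alpha>') < \<kappa>"
      by (auto simp: eventually_sequentially)
    have "cond_risk \<phi> \<alpha>' (\<mu> (\<rho> n)) < cond_risk \<phi> (\<alpha>' + t *\<^sub>R v) (\<mu> (\<rho> n)) + \<kappa>"
      using B[OF \<mu>[of "\<rho> n"] \<alpha>_r[of "\<rho> n"] \<alpha>'_r] near[of "\<rho> n" "\<alpha>' + t *\<^sub>R v"] n
      by (simp add: norm_minus_commute)
    with \<mu> excess show ?thesis by blast
  qed
  obtain \<nu> where \<nu>: "\<nu> \<in> borel_probs" "\<epsilon> \<le> (LINT s|\<nu>. L \<alpha>0 s - L \<beta>0 s)"
      "\<And>\<gamma>. cond_risk \<phi> \<alpha>' \<nu> \<le> cond_risk \<phi> \<gamma> \<nu>"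
    using ex_minimised_measure[OF excess_cont no_descent] by blast
  obtain \<beta> h where h: "h > 0"
      "\<And>\<alpha> \<gamma>. cond_risk L \<gamma> \<nu> < cond_risk L \<alpha> \<nu> \<Longrightarrow> cond_risk \<phi> \<beta> \<nu> + h \<le> cond_risk \<phi> \<alpha> \<nu>"
    using structure_consistent_gap[OF SC \<nu>(1)] by metis
  \<comment> \<open>The loss profile may jump at \<open>\<alpha>'\<close>, so the margin is applied
    to each \<open>\<alpha> n\<close> and carried to \<open>\<alpha>'\<close> by the Lipschitz
    bound.\<close>
  have "cond_risk L \<beta>0 \<nu> < cond_risk L (\<alpha> n) \<nu>" for n
    using \<nu>(2) \<open>\<epsilon> > 0\<close> integrable_cont[OF L_cont \<nu>(1)] by (simp add: cond_risk_def \<alpha>)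
  from h(2)[OF this] have "cond_risk \<phi> \<beta> \<nu> + h \<le> cond_risk \<phi> \<alpha>' \<nu> + B * norm (\<alpha> n - \<alpha>')" for n
    using B[OF \<nu>(1) \<alpha>'_r \<alpha>_r[of n]] order_trans by blast
  then have "cond_risk \<phi> \<beta> \<nu> + h - cond_risk \<phi> \<alpha>' \<nu> \<le> B * norm (\<alpha> (\<rho> n) - \<alpha>')" for n
    by (simp add: algebra_simps)
  then have "cond_risk \<phi> \<beta> \<nu> + h - cond_risk \<phi> \<alpha>' \<nu> \<le> 0"
    by (intro LIMSEQ_le_const[OF B_lim]) auto
  with \<nu>(3)[of \<beta>] h(1) show False by simp
qed

end

section \<open>Derivation of the finite and the convex compact case\<close>

theorem theorem1:
  fixes Q :: "'q set"
    and L \<phi> :: "real ^ 'm \<Rightarrow> 's::topological_space \<Rightarrow> real"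
  assumes "countable Q" and "Q \<noteq> {}"
    and "\<And>\<alpha> s. 0 \<le> L \<alpha> s \<and> L \<alpha> s \<le> 1"
    and "\<And>\<alpha>. continuous_on UNIV (L \<alpha>)"
    and "\<And>\<alpha> s. 0 \<le> \<phi> \<alpha> s"
    and "\<And>\<alpha>. continuous_on UNIV (\<phi> \<alpha>)"
    and "\<And>s. continuous_on UNIV (\<lambda>\<alpha>. \<phi> \<alpha> s)"
    and "\<And>p \<mu>. query_data Q L p \<mu> \<Longrightarrow> \<exists>f\<in>scorers Q. surr_risk Q \<phi> p \<mu> f < \<infinity>"
  shows
    "(finite (UNIV :: 's set) \<and> finite (range (\<lambda>(\<alpha>, s). L \<alpha> s)) \<longrightarrow>
        (structure_consistent L \<phi> \<longrightarrow> uniformly_fisher_consistent Q L \<phi>) \<and>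
        (fisher_consistent Q L \<phi> \<longrightarrow> structure_consistent L \<phi>)) \<and>
     (compact (UNIV :: 's set) \<and>
      (\<exists>(d::nat) P. partition_on UNIV P \<and> finite P \<and> card P = d \<and>
         (\<forall>A\<in>P. \<forall>\<alpha>\<in>A. \<forall>\<alpha>'\<in>A. \<forall>s. L \<alpha> s = L \<alpha>' s)) \<and>
      (\<forall>s. convex_on UNIV (\<lambda>\<alpha>. \<phi> \<alpha> s)) \<and>
      (\<forall>\<mu>\<in>measure_class L. ((\<lambda>\<alpha>. cond_surr \<phi> \<alpha> \<mu>) \<longlongrightarrow> \<infinity>) at_infinity) \<longrightarrow>
        (structure_consistent L \<phi> \<longrightarrow> uniformly_fisher_consistent Q L \<phi>) \<and>
        (fisher_consistent Q L \<phi> \<longrightarrow> structure_consistent L \<phi>))"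
proof -
  have setting: "surrogate_setting L \<phi>" if "compact (UNIV :: 's set)" "finite (range L)"
    using assms that by unfold_locales auto
  have finite_setting: "surrogate_setting L \<phi>"
    if fin: "finite (UNIV :: 's set)" and fin_values: "finite (range (\<lambda>(\<alpha>, s). L \<alpha> s))"
  proof (rule setting)
    show "compact (UNIV :: 's set)" using fin by (rule finite_imp_compact)
    \<comment> \<open>There are only finitely many functions from a finite set of structures to a
      finite set of values.\<close>
    have "range L \<subseteq> Pi\<^sub>E UNIV (\<lambda>_. range (\<lambda>(\<alpha>, s). L \<alpha> s))" by auto
    moreover have "finite (Pi\<^sub>E (UNIV :: 's set) (\<lambda>_. range (\<lambda>(\<alpha>, s). L \<alpha> s)))"
      using fin fin_values by (intro finite_PiE)
    ultimately show "finite (range L)" by (rule finite_subset)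
  qed
  have compact_setting: "surrogate_setting L \<phi>"
    if comp: "compact (UNIV :: 's set)" and P: "partition_on UNIV P" "finite P"
      and const: "\<forall>A\<in>P. \<forall>\<alpha>\<in>A. \<forall>\<alpha>'\<in>A. \<forall>s. L \<alpha> s = L \<alpha>' s" for P
  proof (rule setting)
    have "L \<alpha> \<in> (\<lambda>A. L (SOME \<alpha>. \<alpha> \<in> A)) ` P" for \<alpha>
    proof -
      obtain A where A: "A \<in> P" "\<alpha> \<in> A" using partition_onD1[OF P(1)] by blast
      then have "L \<alpha> = L (SOME \<alpha>. \<alpha> \<in> A)"
        using const someI[of "\<lambda>\<alpha>. \<alpha> \<in> A" \<alpha>] by blast
      with A(1) show ?thesis by blast
    qed
    then have "range L \<subseteq> (\<lambda>A. L (SOME \<alpha>. \<alpha> \<in> A)) ` P" by auto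
    then show "finite (range L)" using P(2) by (rule finite_subset[OF _ finite_imageI])
  qed (rule comp)
  let ?consistency = "(structure_consistent L \<phi> \<longrightarrow> uniformly_fisher_consistent Q L \<phi>) \<and>
    (fisher_consistent Q L \<phi> \<longrightarrow> structure_consistent L \<phi>)"
  have finite_case: ?consistency
    if fin: "finite (UNIV :: 's set)" "finite (range (\<lambda>(\<alpha>, s). L \<alpha> s))"
  proof -
    interpret surrogate_setting L \<phi> using finite_setting[OF fin] .
    have "uniformly_fisher_consistent Q L \<phi>" if SC: "structure_consistent L \<phi>"
    proof (rule uniformly_fisher_consistentI)
      show "\<exists>h>0. surrogate_gap \<epsilon> h" if "\<epsilon> > 0" for \<epsilon>
        by (rule finite_structures_gap[OF fin(1) SC that])
    qed (rule assms(8))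
    moreover have "structure_consistent L \<phi>" if "fisher_consistent Q L \<phi>"
      using fisher_imp_structure_consistent[OF assms(2) that] .
    ultimately show ?thesis by blast
  qed
  have compact_case: ?consistency
    if partition: "compact (UNIV :: 's set)" "partition_on UNIV P" "finite P"
        "\<forall>A\<in>P. \<forall>\<alpha>\<in>A. \<forall>\<alpha>'\<in>A. \<forall>s. L \<alpha> s = L \<alpha>' s"
      and convex: "\<forall>s. convex_on UNIV (\<lambda>\<alpha>. \<phi> \<alpha> s)"
      and coercive: "\<forall>\<mu>\<in>measure_class L. ((\<lambda>\<alpha>. cond_surr \<phi> \<alpha> \<mu>) \<longlongrightarrow> \<infinity>) at_infinity" for P
  proof -
    interpret surrogate_setting L \<phi> using compact_setting[OF partition] .
    interpret convex_coercive_setting L \<phi>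
    proof
      fix s
      show "convex_on UNIV (\<lambda>\<alpha>. \<phi> \<alpha> s)" using convex by blast
      \<comment> \<open>The one-point index set yields a point mass at \<open>s\<close>, which turns
        the assumed coercivity into coercivity of \<open>\<phi>\<close> at \<open>s\<close>.\<close>
      have "sum (\<lambda>_. 1 :: real) {()} = 1" by simp
      then obtain \<mu> where \<mu>: "\<mu> \<in> borel_probs"
          "\<And>g :: 's \<Rightarrow> real. continuous_on UNIV g \<Longrightarrow> (LINT s|\<mu>. g s) = (\<Sum>i\<in>{()}. 1 * g s)"
        using finitely_supported_measure[of "{()}" "\<lambda>_. 1" "\<lambda>_. s"] zero_le_one
          finite.insertI[OF finite.emptyI] by blast
      have "((\<lambda>\<alpha>. cond_surr \<phi> \<alpha> \<mu>) \<longlongrightarrow> \<infinity>) at_infinity"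
        using coercive \<mu>(1) by (simp add: measure_class_eq)
      moreover have "cond_surr \<phi> \<alpha> \<mu> = ennreal (\<phi> \<alpha> s)" for \<alpha>
        using \<mu>(2)[OF surr_cont] by (simp add: cond_surr_eq[OF \<mu>(1)] cond_risk_def)
      ultimately show "filterlim (\<lambda>\<alpha>. \<phi> \<alpha> s) at_top at_infinity"
        by (simp add: ennreal_tendsto_top_eq_at_top)
    qed
    have "uniformly_fisher_consistent Q L \<phi>" if SC: "structure_consistent L \<phi>"
    proof (rule uniformly_fisher_consistentI)
      show "\<exists>h>0. surrogate_gap \<epsilon> h" if "\<epsilon> > 0" for \<epsilon>
        by (rule convex_gap[OF SC that])
    qed (rule assms(8))
    moreover have "structure_consistent L \<phi>" if "fisher_consistent Q L \<phi>"
      using fisher_imp_structure_consistent[OF assms(2) that] .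
    ultimately show ?thesis by blast
  qed
  show ?thesis
    using finite_case compact_case by blast
qed

end
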